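(* Let $\mathcal G$ be an infinite group, let $B=B^{-1} \subseteq \mathcal G$ be a finite generating set containing the identity element of $\mathcal G$, and let $A \subseteq \mathcal G$ be a finite subset. If $|BA| < |A| + \tfrac{1}{2}|A|^{1/3}$, then $\mathcal G$ has a finite normal subgroup $N$ such that $\mathcal G/N$ is either cyclic or dihedral. Furthermore, $|N|< \frac{1}{4} |A|^{1/3}$.
   Context: $BA=\{ba: b\in B, a\in A\}$ and $B^{-1}=\{b^{-1}:b\in B\}$. Cyclic and dihedral groups may be finite or infinite. *)

theory Defs
  imports Complex_Main "HOL-Algebra.Algebra"
begin

(* The semidirect product of Z/n by Z/2 acting by inversion, of order 2n for n > 0. The element
   (a, s) stands for "r^a" if s = False, and for "r^a f" if s = True, with r the rotation and f a
   reflection. Since integer_mod_group 0 is the additive group of the integers, dihedral_group 0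
   is the infinite dihedral group. *)
definition dihedral_group :: "nat \<Rightarrow> (int \<times> bool) monoid" where
  "dihedral_group n =
     \<lparr>carrier = carrier (integer_mod_group n) \<times> UNIV,
      monoid.mult = (\<lambda>(a, s) (b, t).
        (a \<otimes>\<^bsub>integer_mod_group n\<^esub> (if s then inv\<^bsub>integer_mod_group n\<^esub> b else b), s \<noteq> t)),
      one = (\<one>\<^bsub>integer_mod_group n\<^esub>, False)\<rparr>"

lemma group_dihedral_group: "group (dihedral_group n)"
proof -
  interpret Z: comm_group "integer_mod_group n"
    by (rule abelian_integer_mod_group)
  show ?thesis
  proof (rule groupI)
    fix x assume "x \<in> carrier (dihedral_group n)"
    then obtain a s where x: "x = (a, s)" "a \<in> carrier (integer_mod_group n)"
      by (auto simp: dihedral_group_def)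
    let ?y = "(if s then a else inv\<^bsub>integer_mod_group n\<^esub> a, s)"
    have "?y \<in> carrier (dihedral_group n)"
      "?y \<otimes>\<^bsub>dihedral_group n\<^esub> x = \<one>\<^bsub>dihedral_group n\<^esub>"
      using x Z.inv_closed by (auto simp: dihedral_group_def mod_simps simp del: carrier_integer_mod_group)
    then show "\<exists>y\<in>carrier (dihedral_group n). y \<otimes>\<^bsub>dihedral_group n\<^esub> x = \<one>\<^bsub>dihedral_group n\<^esub>"
      by blast
  qed (auto simp: dihedral_group_def Z.m_assoc Z.inv_mult
         simp del: carrier_integer_mod_group mult_integer_mod_group one_integer_mod_group
           inv_integer_mod_group)
qed

definition is_dihedral :: "('a, 'b) monoid_scheme \<Rightarrow> bool" where
  "is_dihedral G \<longleftrightarrow> (\<exists>n. G \<cong> dihedral_group n)"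

end

theory Submission
  imports Defs
begin

text \<open>
  Work in the Cayley graph with edges \<open>x \<longrightarrow> b x\<close>, in which right translations are automorphisms; let
  \<open>k\<close> be the size of the outer boundary \<open>BA - A\<close>, so that \<open>8 k\<^sup>3 < |A|\<close>. Averaging over a ball of
  radius \<open>4 k\<^sup>2\<close> shows that this ball has fewer than \<open>2 |A|\<close> elements, whereas it contains \<open>2 k\<close>
  disjoint balls of radius \<open>k - 1\<close>. Hence \<open>A\<close> is not covered by the balls of radius \<open>k - 1\<close> around its
  boundary and so contains such a ball. As a boundary has at least two elements, the least boundary
  of a finite set containing a ball of radius \<open>r\<close> takes the same value \<open>q \<le> k\<close> at two consecutive
  radii \<open>r < k\<close>. By submodularity, sets that attain \<open>q\<close> can then be united along any connected set of
  translations. This gives arbitrarily large finite sets with boundary at most \<open>q\<close>, which bounds the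
  number of ends by \<open>q\<close>, hence by two, and, along a geodesic ray, an infinite set \<open>U\<close> with infinite
  complement and finite boundary. The displacement \<open>|U - Ug| - |Ug - U|\<close> is a homomorphism to the
  integers on the subgroup (of index at most two) that fixes the ends; its kernel \<open>N\<close> is finite, and
  the quotient by \<open>N\<close> is cyclic or dihedral. Finally a large finite \<open>N\<close>-invariant set with boundary at
  most \<open>q\<close> has at least two cosets of \<open>N\<close> in its boundary, so \<open>2 |N| \<le> q \<le> k\<close>.
\<close>

section \<open>Boundaries and balls in Cayley graphs\<close>

context group begin

lemma set_mult_iff: "x \<in> H <#> K \<longleftrightarrow> (\<exists>h\<in>H. \<exists>k\<in>K. x = h \<otimes> k)"
  by (auto simp: set_mult_def)

lemma set_multI: "h \<in> H \<Longrightarrow> k \<in> K \<Longrightarrow> h \<otimes> k \<in> H <#> K"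
  by (auto simp: set_mult_def)

lemma finite_set_mult: "finite H \<Longrightarrow> finite K \<Longrightarrow> finite (H <#> K)"
  by (auto simp: set_mult_def)

lemma r_coset_image: "S #> g = (\<lambda>x. x \<otimes> g) ` S"
  by (auto simp: r_coset_def)

lemma inj_on_r_mult: "g \<in> carrier G \<Longrightarrow> inj_on (\<lambda>x. x \<otimes> g) (carrier G)"
  by (auto simp: inj_on_def)

lemma mem_r_coset:
  assumes "S \<subseteq> carrier G" "g \<in> carrier G"
  shows "x \<in> S #> g \<longleftrightarrow> x \<in> carrier G \<and> x \<otimes> inv g \<in> S"
proof
  assume "x \<in> S #> g"
  then show "x \<in> carrier G \<and> x \<otimes> inv g \<in> S"
    using assms by (auto simp: r_coset_image m_assoc subsetD)
next
  assume x: "x \<in> carrier G \<and> x \<otimes> inv g \<in> S"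
  then have "x = (x \<otimes> inv g) \<otimes> g" using assms by (simp add: m_assoc)
  then show "x \<in> S #> g" unfolding r_coset_image using x by blast
qed

lemma r_coset_Int:
  assumes "S \<subseteq> carrier G" "T \<subseteq> carrier G" "g \<in> carrier G"
  shows "(S \<inter> T) #> g = (S #> g) \<inter> (T #> g)"
  unfolding r_coset_image by (rule inj_on_image_Int[OF inj_on_r_mult]) (use assms in auto)

lemma r_coset_Diff:
  assumes "S \<subseteq> carrier G" "T \<subseteq> carrier G" "g \<in> carrier G"
  shows "(S - T) #> g = (S #> g) - (T #> g)"
  unfolding r_coset_image by (rule inj_on_image_set_diff[OF inj_on_r_mult]) (use assms in auto)

lemma r_coset_mono: "S \<subseteq> T \<Longrightarrow> S #> g \<subseteq> T #> g"
  by (auto simp: r_coset_image)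

lemma card_r_coset: "S \<subseteq> carrier G \<Longrightarrow> g \<in> carrier G \<Longrightarrow> card (S #> g) = card S"
  unfolding r_coset_image by (rule card_image) (auto simp: inj_on_def subsetD)

lemma finite_r_coset: "finite S \<Longrightarrow> finite (S #> g)"
  by (simp add: r_coset_image)

lemma finite_r_coset_iff:
  "S \<subseteq> carrier G \<Longrightarrow> g \<in> carrier G \<Longrightarrow> finite (S #> g) \<longleftrightarrow> finite S"
  unfolding r_coset_image by (rule finite_image_iff) (auto simp: inj_on_def subsetD)

lemma r_coset_carrier: "g \<in> carrier G \<Longrightarrow> carrier G #> g = carrier G"
  by (auto simp: mem_r_coset)

lemma r_coset_Compl:
  "S \<subseteq> carrier G \<Longrightarrow> g \<in> carrier G \<Longrightarrow> (carrier G - S) #> g = carrier G - (S #> g)"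
  by (simp add: r_coset_Diff r_coset_carrier)

end

section \<open>Boundaries, connectedness and balls\<close>

locale cayley_graph = group G for G :: "('a, 'b) monoid_scheme" (structure) +
  fixes B :: "'a set"
  assumes B_closed: "B \<subseteq> carrier G"
    and finite_B: "finite B"
    and inv_B: "b \<in> B \<Longrightarrow> inv b \<in> B"
    and one_B: "\<one> \<in> B"
    and generate_B: "generate G B = carrier G"
    and infinite_G: "infinite (carrier G)"
begin

definition bd :: "'a set \<Rightarrow> 'a set"
  where "bd S = (B <#> S) - S"

text \<open>Balls about \<open>\<one>\<close>. Since right translations are the automorphisms of
  this graph, the ball about \<open>g\<close> is \<open>ball n #> g\<close>.\<close>

primrec ball :: "nat \<Rightarrow> 'a set" where
  "ball 0 = {\<one>}"
| "ball (Suc n) = B <#> ball n"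

lemma B_carrier [simp]: "b \<in> B \<Longrightarrow> b \<in> carrier G"
  using B_closed by blast

lemma bd_closed: "S \<subseteq> carrier G \<Longrightarrow> bd S \<subseteq> carrier G"
  unfolding bd_def using set_mult_closed[OF B_closed] by blast

lemma finite_bd: "finite S \<Longrightarrow> finite (bd S)"
  unfolding bd_def using finite_set_mult[OF finite_B] by blast

lemma bdI: "b \<in> B \<Longrightarrow> s \<in> S \<Longrightarrow> b \<otimes> s \<notin> S \<Longrightarrow> b \<otimes> s \<in> bd S"
  by (auto simp: bd_def intro: set_multI)

lemma bdE:
  assumes "x \<in> bd S"
  obtains b s where "b \<in> B" "s \<in> S" "x = b \<otimes> s" "x \<notin> S"
  using assms by (auto simp: bd_def set_mult_iff)

lemma nb_r_coset:
  "S \<subseteq> carrier G \<Longrightarrow> g \<in> carrier G \<Longrightarrow> B <#> (S #> g) = (B <#> S) #> g"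
  by (rule setmult_rcos_assoc[OF B_closed])

lemma bd_r_coset: "S \<subseteq> carrier G \<Longrightarrow> g \<in> carrier G \<Longrightarrow> bd (S #> g) = bd S #> g"
  unfolding bd_def by (simp add: nb_r_coset r_coset_Diff set_mult_closed B_closed)

lemma card_bd_r_coset: "S \<subseteq> carrier G \<Longrightarrow> g \<in> carrier G \<Longrightarrow> card (bd (S #> g)) = card (bd S)"
  by (simp add: bd_r_coset card_r_coset bd_closed)

lemma subset_nb: "S \<subseteq> carrier G \<Longrightarrow> S \<subseteq> B <#> S"
proof
  fix x assume "S \<subseteq> carrier G" "x \<in> S"
  then show "x \<in> B <#> S" using set_multI[OF one_B, of x S] by (auto simp: subsetD)
qed

lemma card_nb: "finite S \<Longrightarrow> S \<subseteq> carrier G \<Longrightarrow> card (B <#> S) = card S + card (bd S)"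
  unfolding bd_def
  by (metis card_Diff_subset card_mono finite_B finite_set_mult le_add_diff_inverse subset_nb)

text \<open>Neighbourhoods commute with unions, while that of an intersection is only contained in
  the intersection of the neighbourhoods. Inclusion-exclusion for the neighbourhoods, minus that for
  the sets themselves, gives the inequality.\<close>

lemma card_bd_submodular:
  assumes "finite S" "finite T" "S \<subseteq> carrier G" "T \<subseteq> carrier G"
  shows "card (bd (S \<inter> T)) + card (bd (S \<union> T)) \<le> card (bd S) + card (bd T)"
proof -
  have U: "B <#> (S \<union> T) = (B <#> S) \<union> (B <#> T)" unfolding set_mult_def by blast
  have I: "B <#> (S \<inter> T) \<subseteq> (B <#> S) \<inter> (B <#> T)" unfolding set_mult_def by blast
  have fin: "finite (B <#> S)" "finite (B <#> T)" using assms finite_set_mult finite_B by auto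
  have "card (B <#> (S \<inter> T)) + card (B <#> (S \<union> T)) \<le> card (B <#> S) + card (B <#> T)"
    unfolding U using card_mono[OF _ I] card_Un_Int[OF fin] fin by simp
  moreover have "card (B <#> (S \<inter> T)) = card (S \<inter> T) + card (bd (S \<inter> T))"
      "card (B <#> (S \<union> T)) = card (S \<union> T) + card (bd (S \<union> T))"
      "card (B <#> S) = card S + card (bd S)" "card (B <#> T) = card T + card (bd T)"
    using assms by (auto intro!: card_nb)
  ultimately show ?thesis using card_Un_Int[OF assms(1,2)] by linarith
qed

text \<open>An empty boundary means closure under left multiplication by \<open>B\<close>, hence by
  the whole group; \<open>x\<close> is then reached from \<open>s\<close> through the factor
  \<open>x \<otimes> inv s\<close>.\<close>

lemma connected_carrier:
  assumes S: "S \<subseteq> carrier G" "S \<noteq> {}" and bd: "bd S = {}"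
  shows "S = carrier G"
proof -
  have step: "b \<otimes> s \<in> S" if "b \<in> B" "s \<in> S" for b s
    using bdI[OF that] bd by blast
  have all: "\<forall>s\<in>S. g \<otimes> s \<in> S" if "g \<in> generate G B" for g
    using that
  proof induction
    case (eng h1 h2)
    have "h1 \<in> carrier G" "h2 \<in> carrier G" using eng generate_B by auto
    then show ?case using eng S by (auto simp: m_assoc subsetD)
  qed (use S step inv_B in auto)
  obtain s where s: "s \<in> S" using S by blast
  have "x \<in> S" if x: "x \<in> carrier G" for x
  proof -
    have sc: "s \<in> carrier G" using s S by auto
    have "(x \<otimes> inv s) \<otimes> s \<in> S" using all s x sc generate_B by blast
    then show ?thesis using x sc by (simp add: m_assoc)
  qed
  then show ?thesis using S by blast
qed

lemma bd_nonempty: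
  assumes "S \<subseteq> carrier G" "S \<noteq> {}" "S \<noteq> carrier G"
  shows "bd S \<noteq> {}"
  using connected_carrier assms by blast

lemma bd_nonempty_finite:
  assumes "finite S" "S \<subseteq> carrier G" "S \<noteq> {}"
  shows "bd S \<noteq> {}"
  using bd_nonempty assms infinite_G by blast

lemma ball_closed: "ball n \<subseteq> carrier G"
  by (induction n) (auto intro: set_mult_closed[OF B_closed, THEN subsetD])

lemma ball_carrier: "x \<in> ball n \<Longrightarrow> x \<in> carrier G"
  using ball_closed by blast

lemma finite_ball: "finite (ball n)"
  by (induction n) (auto intro: finite_set_mult finite_B)

lemma ball_SucI: "b \<in> B \<Longrightarrow> x \<in> ball n \<Longrightarrow> b \<otimes> x \<in> ball (Suc n)"
  by (auto intro: set_multI)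

lemma ball_Suc_mono: "ball n \<subseteq> ball (Suc n)"
  using subset_nb[OF ball_closed] by simp

lemma ball_mono: "m \<le> n \<Longrightarrow> ball m \<subseteq> ball n"
  using lift_Suc_mono_le[of ball, OF ball_Suc_mono] by blast

lemma one_ball [simp]: "\<one> \<in> ball n"
  using ball_mono[of 0 n] by auto

lemma ball_add: "ball m <#> ball n = ball (m + n)"
proof (induction m)
  case 0
  have "{\<one>} <#> ball n = ball n"
    using ball_closed[of n] by (auto simp: set_mult_def subsetD)
  then show ?case by simp
next
  case (Suc m)
  have "B <#> ball m <#> ball n = B <#> (ball m <#> ball n)"
    by (rule set_mult_assoc) (auto simp: B_closed ball_carrier)
  with Suc show ?case by simp
qed

lemma ball_1: "ball (Suc 0) = B"
  using B_closed by (auto simp: set_mult_iff subsetD)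

lemma ball_mult: "x \<in> ball m \<Longrightarrow> y \<in> ball n \<Longrightarrow> x \<otimes> y \<in> ball (m + n)"
  using set_multI ball_add by metis

lemma ball_inv: "x \<in> ball n \<Longrightarrow> inv x \<in> ball n"
proof (induction n arbitrary: x)
  case (Suc n)
  then obtain b y where bx: "b \<in> B" "y \<in> ball n" "x = b \<otimes> y" by (auto simp: set_mult_iff)
  have "inv x = inv y \<otimes> inv b" using bx ball_carrier by (simp add: inv_mult_group)
  moreover have "inv y \<otimes> inv b \<in> ball (n + Suc 0)"
    by (rule ball_mult) (use Suc bx inv_B ball_1 in auto)
  ultimately show ?case by simp
qed auto

lemma carrier_eq_UN_ball: "carrier G = (\<Union>n. ball n)"
proof -
  have "bd (\<Union>n. ball n) = {}"
    unfolding bd_def set_mult_def using ball_SucI by (fastforce simp del: ball.simps)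
  moreover have "(\<Union>n. ball n) \<noteq> {}" using one_ball by blast
  ultimately show ?thesis
    using connected_carrier[of "\<Union>n. ball n"] ball_carrier by blast
qed

lemma finite_subset_ball:
  assumes "finite S" "S \<subseteq> carrier G"
  obtains n where "S \<subseteq> ball n"
proof -
  have "\<exists>n. S \<subseteq> ball n"
    using assms
  proof induction
    case (insert x S)
    then obtain n m where "S \<subseteq> ball n" "x \<in> ball m" using carrier_eq_UN_ball by auto
    then have "insert x S \<subseteq> ball (max n m)"
      using ball_mono[of n "max n m"] ball_mono[of m "max n m"] by auto
    then show ?case by blast
  qed auto
  with that show thesis by blast
qed

text \<open>If the boundary of \<open>Y\<close> were a single coset of \<open>N\<close>, a translate \<open>Y'\<close> of \<open>Y\<close> would have its
  boundary inside \<open>Y\<close>; then \<open>Y' - Y\<close> has empty boundary, so \<open>Y' = Y\<close>, which is absurd.\<close>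

lemma card_bd_ge_twice_normal:
  assumes N: "N \<lhd> G" "finite N"
    and Y: "finite Y" "Y \<subseteq> carrier G" "Y \<noteq> {}"
    and inv: "\<And>n. n \<in> N \<Longrightarrow> Y #> n = Y"
  shows "2 * card N \<le> card (bd Y)"
proof -
  interpret N: normal N G by fact
  have Nc: "N \<subseteq> carrier G" by (rule N.subset)
  have lc: "x <# N \<subseteq> bd Y" if "x \<in> bd Y" for x
  proof
    fix z assume "z \<in> x <# N"
    then obtain n where n: "n \<in> N" "z = x \<otimes> n" by (auto simp: l_coset_def)
    have "bd Y #> n = bd Y" using bd_r_coset[of Y n] inv[of n] n Y Nc by auto
    then show "z \<in> bd Y" using n that by (auto simp: r_coset_image)
  qed
  have cl: "card (x <# N) = card N" if "x \<in> carrier G" for x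
  proof -
    have "x <# N = (\<lambda>n. x \<otimes> n) ` N" by (auto simp: l_coset_def)
    moreover have "inj_on (\<lambda>n. x \<otimes> n) N" using that Nc by (auto simp: inj_on_def subsetD)
    ultimately show ?thesis by (simp add: card_image)
  qed
  obtain x where x: "x \<in> bd Y" using bd_nonempty_finite[OF Y] by blast
  have xc: "x \<in> carrier G" using x bd_closed Y by blast
  show ?thesis
  proof (cases "bd Y = x <# N")
    case False
    then obtain x' where x': "x' \<in> bd Y" "x' \<notin> x <# N" using lc[OF x] by blast
    have x'c: "x' \<in> carrier G" using x' bd_closed Y by blast
    have "(x <# N) \<inter> (x' <# N) = {}"
    proof (rule ccontr)
      assume "(x <# N) \<inter> (x' <# N) \<noteq> {}"
      then obtain n m where nm: "n \<in> N" "m \<in> N" "x \<otimes> n = x' \<otimes> m" by (auto simp: l_coset_def)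
      have nc: "n \<in> carrier G" "m \<in> carrier G" using nm Nc by auto
      have "x' = x \<otimes> (n \<otimes> inv m)"
        using nm nc xc x'c by (metis inv_closed inv_solve_right m_assoc m_closed)
      then show False using x' nm by (auto simp: l_coset_def)
    qed
    then have "card (x <# N) + card (x' <# N) = card ((x <# N) \<union> (x' <# N))"
      using N by (subst card_Un_disjoint) (auto simp: l_coset_def)
    also have "\<dots> \<le> card (bd Y)"
      using lc x x' by (intro card_mono finite_bd Y) auto
    finally show ?thesis using cl xc x'c by simp
  next
    case True
    obtain y where y: "y \<in> Y" using Y by blast
    have yc: "y \<in> carrier G" using y Y by auto
    \<comment> \<open>Translation by \<open>g\<close> moves the boundary point \<open>x\<close> to
      \<open>y \<in> Y\<close>; normality of \<open>N\<close> then carries the whole coset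
      \<open>bd Y\<close> into \<open>Y\<close>.\<close>
    define g where "g = inv x \<otimes> y"
    have gc: "g \<in> carrier G" unfolding g_def using xc yc by auto
    define Y' where "Y' = Y #> g"
    have Y'c: "Y' \<subseteq> carrier G" unfolding Y'_def using Y gc by (simp add: r_coset_subset_G)
    have Y'_inv: "Y' #> n = Y'" if n: "n \<in> N" for n
    proof -
      have nc: "n \<in> carrier G" using n Nc by auto
      have "g \<otimes> n \<in> N #> g" using N.coset_eq gc n by (auto simp: l_coset_def)
      then obtain m where m: "m \<in> N" "g \<otimes> n = m \<otimes> g" by (auto simp: r_coset_def)
      have "Y' #> n = (Y #> m) #> g"
        unfolding Y'_def using Y gc nc m Nc by (simp add: coset_mult_assoc subsetD)
      then show ?thesis using inv m Y'_def by simp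
    qed
    have bdY': "bd Y' \<subseteq> Y"
    proof
      fix z assume "z \<in> bd Y'"
      then obtain n where n: "n \<in> N" "z = (x \<otimes> n) \<otimes> g"
        unfolding Y'_def bd_r_coset[OF Y(2) gc] True by (auto simp: r_coset_image l_coset_def)
      have nc: "n \<in> carrier G" using n Nc by auto
      have "N #> g = g <# N" using N.coset_eq gc by auto
      then obtain m where m: "m \<in> N" "n \<otimes> g = g \<otimes> m"
        using n unfolding r_coset_def l_coset_def by blast
      have mc: "m \<in> carrier G" using m Nc by auto
      have "x \<otimes> g = y" using xc yc by (simp add: g_def m_assoc[symmetric])
      then have "z = y \<otimes> m" using n m xc nc gc mc by (simp add: m_assoc flip: m_assoc[of x g m])
      then have "z \<in> Y #> m" using y by (auto simp: r_coset_image)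
      then show "z \<in> Y" using inv m by simp
    qed
    define Z where "Z = Y' - Y"
    \<comment> \<open>Otherwise \<open>Y'\<close> contains all of \<open>bd Y\<close>, so each of
      the two sets absorbs the boundary of the other and the finite set \<open>Y \<union> Y'\<close>
      has empty boundary.\<close>
    have "x \<notin> Y'"
    proof
      assume "x \<in> Y'"
      have "bd (Y \<union> Y') \<subseteq> (bd Y \<union> bd Y') - (Y \<union> Y')"
        unfolding bd_def set_mult_def by blast
      moreover have "bd Y \<subseteq> Y'"
      proof
        fix z assume "z \<in> bd Y"
        then obtain n where n: "n \<in> N" "z = x \<otimes> n" using True by (auto simp: l_coset_def)
        then show "z \<in> Y'" using n Y'_inv[of n] \<open>x \<in> Y'\<close> by (auto simp: r_coset_image)
      qed
      ultimately have "bd (Y \<union> Y') = {}" using bdY' by blast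
      then show False
        using bd_nonempty_finite[of "Y \<union> Y'"] Y Y'c by (auto simp: Y'_def finite_r_coset)
    qed
    \<comment> \<open>A step from \<open>z\<close> out of \<open>Z\<close> lands in
      \<open>Y\<close>, directly or through \<open>bd Y' \<subseteq> Y\<close>. So \<open>z\<close>
      lies in \<open>bd Y\<close>, and right invariance of \<open>Y'\<close> under \<open>N\<close>
      would put \<open>x\<close> into \<open>Y'\<close>.\<close>
    have "bd Z = {}"
    proof (rule ccontr)
      assume "bd Z \<noteq> {}"
      then obtain b z where bz: "b \<in> B" "z \<in> Z" "b \<otimes> z \<notin> Z" by (metis bdE equals0I)
      have zc: "z \<in> carrier G" using bz Y'c unfolding Z_def by auto
      have "b \<otimes> z \<in> Y"
        using bz bdI[of b z Y'] bdY' unfolding Z_def by auto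
      moreover have "z = inv b \<otimes> (b \<otimes> z)" using bz zc by (simp add: m_assoc[symmetric])
      ultimately have "z \<in> B <#> Y" using inv_B[OF bz(1)] by (auto simp: set_mult_iff)
      then have "z \<in> bd Y" using bz unfolding Z_def bd_def by auto
      then obtain n where n: "n \<in> N" "z = x \<otimes> n" using True by (auto simp: l_coset_def)
      have nc: "n \<in> carrier G" using n Nc by auto
      have "z \<otimes> inv n \<in> Y' #> inv n" using bz by (auto simp: r_coset_image Z_def)
      then have "z \<otimes> inv n \<in> Y'" using Y'_inv n by simp
      moreover have "z \<otimes> inv n = x" using n nc xc by (simp add: m_assoc)
      ultimately show False using \<open>x \<notin> Y'\<close> by simp
    qed
    then have "Z = {}"
      using bd_nonempty_finite[of Z] Y Y'c by (auto simp: Z_def Y'_def finite_r_coset)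
    then have "Y' \<subseteq> Y" unfolding Z_def by blast
    moreover have "card Y' = card Y" unfolding Y'_def by (rule card_r_coset[OF Y(2) gc])
    ultimately have "Y' = Y" using Y card_subset_eq by blast
    \<comment> \<open>Now \<open>bd Y \<subseteq> Y\<close>, but a boundary is disjoint from its set
      and this one is nonempty.\<close>
    then have False using bdY' bd_nonempty_finite[OF Y] by (auto simp: bd_def)
    then show ?thesis ..
  qed
qed

section \<open>Growth and depth\<close>

text \<open>Each letter of a word for \<open>g\<close> pushes at most \<open>card (bd A)\<close>
  further points out of \<open>A\<close>.\<close>

lemma card_translate_diff_le:
  assumes A: "finite A" "A \<subseteq> carrier G" and g: "g \<in> ball n"
  shows "card ((g <# A) - A) \<le> n * card (bd A)"
  using g
proof (induction n arbitrary: g)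
  case 0
  then show ?case using A by (simp add: lcos_mult_one)
next
  case (Suc n)
  then obtain b h where bh: "b \<in> B" "h \<in> ball n" "g = b \<otimes> h" by (auto simp: set_mult_iff)
  have "(g <# A) - A \<subseteq> (\<lambda>x. b \<otimes> x) ` ((h <# A) - A) \<union> bd A"
  proof
    fix x assume x: "x \<in> (g <# A) - A"
    then obtain a where a: "a \<in> A" "x = g \<otimes> a" by (auto simp: l_coset_def)
    have ac: "a \<in> carrier G" using a A by auto
    have xb: "x = b \<otimes> (h \<otimes> a)" using a ac bh ball_carrier by (simp add: m_assoc)
    show "x \<in> (\<lambda>x. b \<otimes> x) ` ((h <# A) - A) \<union> bd A"
    proof (cases "h \<otimes> a \<in> A")
      case True
      then show ?thesis using bdI[OF bh(1) True] x xb by auto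
    next
      case False
      then have "h \<otimes> a \<in> (h <# A) - A" using a by (auto simp: l_coset_def)
      then show ?thesis using xb by blast
    qed
  qed
  moreover have fin: "finite ((h <# A) - A)" using A by (auto simp: l_coset_def)
  ultimately have "card ((g <# A) - A) \<le> card ((\<lambda>x. b \<otimes> x) ` ((h <# A) - A) \<union> bd A)"
    using A finite_bd by (intro card_mono) auto
  also have "\<dots> \<le> card ((\<lambda>x. b \<otimes> x) ` ((h <# A) - A)) + card (bd A)"
    by (rule card_Un_le)
  also have "\<dots> \<le> n * card (bd A) + card (bd A)"
    using card_image_le[OF fin, of "\<lambda>x. b \<otimes> x"] Suc.IH[OF bh(2)] by linarith
  finally show ?case by simp
qed

text \<open>Averaging \<open>card (gA \<inter> A)\<close> over the ball (Coulhon and Saloff-Coste).\<close>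

lemma card_le_of_card_ball_ge:
  assumes A: "finite A" "A \<subseteq> carrier G" "A \<noteq> {}"
    and large: "2 * card A \<le> card (ball s)"
  shows "card A \<le> 2 * s * card (bd A)"
proof (rule ccontr)
  assume "\<not> card A \<le> 2 * s * card (bd A)"
  then have less: "2 * (s * card (bd A)) < card A" by simp
  \<comment> \<open>These pairs are counted in two ways. \<open>(g, a)\<close> is recovered from
    \<open>(a, g \<otimes> a)\<close>, so there are at most \<open>card A * card A\<close>; yet each
    \<open>g\<close> in the ball moves fewer than half of the points of \<open>A\<close> out of
    \<open>A\<close>.\<close>
  define P where "P = (SIGMA g : ball s. {a \<in> A. g \<otimes> a \<in> A})"
  have "card P \<le> card (A \<times> A)"
  proof (rule card_inj_on_le)
    show "inj_on (\<lambda>(g, a). (a, g \<otimes> a)) P"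
      using A by (auto simp: inj_on_def P_def ball_carrier subsetD)
    show "(\<lambda>(g, a). (a, g \<otimes> a)) ` P \<subseteq> A \<times> A" by (auto simp: P_def)
  qed (use A in auto)
  then have PA: "card P \<le> card A * card A" by (simp add: card_cartesian_product)
  have each: "card A < 2 * card {a \<in> A. g \<otimes> a \<in> A}" if g: "g \<in> ball s" for g
  proof -
    have inj: "inj_on (\<lambda>a. g \<otimes> a) A" using g A by (auto simp: inj_on_def ball_carrier subsetD)
    have "(\<lambda>a. g \<otimes> a) ` {a \<in> A. g \<otimes> a \<notin> A} = (g <# A) - A" by (auto simp: l_coset_def)
    moreover have "card ((\<lambda>a. g \<otimes> a) ` {a \<in> A. g \<otimes> a \<notin> A}) = card {a \<in> A. g \<otimes> a \<notin> A}"
      by (rule card_image, rule inj_on_subset[OF inj]) blast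
    ultimately have "card {a \<in> A. g \<otimes> a \<notin> A} = card ((g <# A) - A)" by (simp only:)
    moreover have "card A = card {a \<in> A. g \<otimes> a \<in> A} + card {a \<in> A. g \<otimes> a \<notin> A}"
      using card_Int_Diff[OF A(1), of "{a. g \<otimes> a \<in> A}"] by (simp add: Int_def set_diff_eq)
    ultimately show ?thesis using card_translate_diff_le[OF A(1,2) g] less by linarith
  qed
  have "card (ball s) * card A = (\<Sum>g\<in>ball s. card A)" by simp
  also have "\<dots> < (\<Sum>g\<in>ball s. 2 * card {a \<in> A. g \<otimes> a \<in> A})"
    by (rule sum_strict_mono) (use finite_ball one_ball each in blast)+
  also have "\<dots> = 2 * card P"
    unfolding P_def using A by (subst card_SigmaI) (auto simp: finite_ball sum_distrib_left)
  also have "\<dots> \<le> 2 * (card A * card A)" using PA by simp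
  also have "\<dots> \<le> card (ball s) * card A" using large by (simp add: mult_le_mono1 flip: mult.assoc)
  finally show False by simp
qed

section \<open>Geodesic rays and disjoint balls along them\<close>

definition geodesic_ray :: "(nat \<Rightarrow> 'a) \<Rightarrow> bool"
  where "geodesic_ray y \<longleftrightarrow> y 0 = \<one> \<and> (\<forall>n. \<exists>b\<in>B. y (Suc n) = b \<otimes> y n)
    \<and> (\<forall>m n. m < n \<longrightarrow> y n \<notin> ball m)"

lemma geodesic_ray_ball: "geodesic_ray y \<Longrightarrow> y n \<in> ball n"
proof (induction n)
  case (Suc n)
  then obtain b where "b \<in> B" "y (Suc n) = b \<otimes> y n" unfolding geodesic_ray_def by blast
  then show ?case using ball_SucI Suc by metis
qed (auto simp: geodesic_ray_def)

lemma geodesic_ray_carrier: "geodesic_ray y \<Longrightarrow> y n \<in> carrier G"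
  using geodesic_ray_ball ball_carrier by blast

text \<open>\<open>x \<otimes> y n\<close> has word length at most \<open>m + n\<close>, while
  \<open>y p\<close> has length exactly \<open>p\<close>.\<close>

lemma geodesic_ray_far:
  assumes "geodesic_ray y" "x \<in> ball m" "n + m < p"
  shows "y p \<noteq> x \<otimes> y n"
  using ball_mult[OF assms(2) geodesic_ray_ball[OF assms(1)], of n] assms
  unfolding geodesic_ray_def by (metis add.commute)

text \<open>A ray is built by always stepping away from \<open>\<one>\<close> into a neighbour whose cone (the elements
  reached through it by geodesics) is infinite; the cone of \<open>x\<close> is covered by \<open>x\<close> and the
  cones of its finitely many outer neighbours.\<close>

lemma ex_geodesic_ray: "\<exists>y. geodesic_ray y"
proof -
  define sph where "sph n = ball n - (\<Union>m<n. ball m)" for n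
  define cone where "cone n x = {z \<otimes> x |z m. z \<in> ball m \<and> z \<otimes> x \<in> sph (m + n)}" for n x
  define Good where "Good n x \<longleftrightarrow> x \<in> sph n \<and> infinite (cone n x)" for n x
  have ex_sph: "\<exists>n. x \<in> sph n" if "x \<in> carrier G" for x
  proof -
    have "\<exists>n. x \<in> ball n" using that carrier_eq_UN_ball by blast
    then have "x \<in> ball (LEAST n. x \<in> ball n)" by (rule LeastI_ex)
    then have "x \<in> sph (LEAST n. x \<in> ball n)" unfolding sph_def by (auto dest: not_less_Least)
    then show ?thesis ..
  qed
  have base: "Good 0 \<one>"
  proof -
    have "carrier G \<subseteq> cone 0 \<one>"
    proof
      fix x assume x: "x \<in> carrier G"
      then obtain n where "x \<in> sph n" using ex_sph by blast
      then have "x \<in> ball n \<and> x \<otimes> \<one> \<in> sph (n + 0)" using x by (simp add: sph_def)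
      then show "x \<in> cone 0 \<one>" unfolding cone_def using x by (force intro!: exI[of _ x])
    qed
    then show ?thesis using infinite_G finite_subset unfolding Good_def by (auto simp: sph_def)
  qed
  have step: "\<exists>x'. Good (Suc n) x' \<and> (\<exists>b\<in>B. x' = b \<otimes> x)" if g: "Good n x" for n x
  proof -
    have xs: "x \<in> sph n" using g by (simp add: Good_def)
    then have xc: "x \<in> carrier G" unfolding sph_def using ball_carrier by blast
    have "cone n x \<subseteq> {x} \<union> (\<Union>b\<in>{b\<in>B. b \<otimes> x \<in> sph (Suc n)}. cone (Suc n) (b \<otimes> x))"
    proof
      fix w assume "w \<in> cone n x"
      then obtain z m where z: "z \<in> ball m" "w = z \<otimes> x" "w \<in> sph (m + n)" by (auto simp: cone_def)
      show "w \<in> {x} \<union> (\<Union>b\<in>{b\<in>B. b \<otimes> x \<in> sph (Suc n)}. cone (Suc n) (b \<otimes> x))"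
      proof (cases m)
        case 0
        then show ?thesis using z xc by simp
      next
        case (Suc k)
        \<comment> \<open>This splits off the rightmost letter of \<open>z\<close>, the one applied
          to \<open>x\<close> first; the recursion for \<open>ball\<close> exposes only the
          leftmost.\<close>
        then have "z \<in> ball k <#> ball (Suc 0)" using z by (simp only: ball_add) simp
        then obtain z' b where zb: "z' \<in> ball k" "b \<in> B" "z = z' \<otimes> b"
          unfolding ball_1 by (auto simp: set_mult_iff)
        have wz: "w = z' \<otimes> (b \<otimes> x)" using zb z xc ball_carrier by (simp add: m_assoc)
        have "b \<otimes> x \<in> ball (Suc n)" using xs zb unfolding sph_def by (auto intro: set_multI)
        \<comment> \<open>A shorter word for \<open>b \<otimes> x\<close> would shorten
          \<open>w\<close> below its length \<open>m + n\<close>.\<close>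
        moreover have "b \<otimes> x \<notin> ball j" if "j < Suc n" for j
        proof
          assume "b \<otimes> x \<in> ball j"
          then have "w \<in> ball (k + j)" using wz zb ball_mult by blast
          moreover have "k + j < m + n" using Suc that by simp
          ultimately show False using z(3) unfolding sph_def by blast
        qed
        ultimately have "b \<otimes> x \<in> sph (Suc n)" unfolding sph_def by blast
        moreover have "w \<in> cone (Suc n) (b \<otimes> x)"
          unfolding cone_def using wz zb z(3) Suc by auto
        ultimately show ?thesis using zb by blast
      qed
    qed
    moreover have "infinite (cone n x)" using g by (simp add: Good_def)
    ultimately have "infinite (\<Union>b\<in>{b\<in>B. b \<otimes> x \<in> sph (Suc n)}. cone (Suc n) (b \<otimes> x))"
      by (meson finite.emptyI finite.insertI finite_UnI finite_subset)
    then obtain b where "b \<in> B" "b \<otimes> x \<in> sph (Suc n)" "infinite (cone (Suc n) (b \<otimes> x))"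
      using finite_B by auto
    then show ?thesis unfolding Good_def by blast
  qed
  obtain y where y: "\<And>n. Good n (y n)" "y 0 = \<one>" "\<And>n. \<exists>b\<in>B. y (Suc n) = b \<otimes> y n"
  proof -
    have "\<exists>f. \<forall>n. (Good n (f n) \<and> (n = 0 \<longrightarrow> f n = \<one>)) \<and> (\<exists>b\<in>B. f (Suc n) = b \<otimes> f n)"
      by (rule dependent_nat_choice) (use base step in auto)
    then show thesis using that by metis
  qed
  then show ?thesis
    by (intro exI[of _ y], unfold geodesic_ray_def) (auto simp: Good_def sph_def)
qed

text \<open>A word for \<open>h\<close> traces a path from \<open>a\<close> to
  \<open>h \<otimes> a\<close>; its first vertex outside \<open>A\<close> is the required
  one.\<close>

lemma exits_through_bd:
  assumes "a \<in> A" "A \<subseteq> carrier G" "h \<in> ball n" "h \<otimes> a \<notin> A"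
  shows "\<exists>v\<in>bd A. v \<in> ball n #> a"
  using assms(3,4)
proof (induction n arbitrary: h)
  case 0
  then show ?case using assms by auto
next
  case (Suc n)
  then obtain b h' where bh: "b \<in> B" "h' \<in> ball n" "h = b \<otimes> h'" by (auto simp: set_mult_iff)
  have ac: "a \<in> carrier G" using assms by auto
  show ?case
  proof (cases "h' \<otimes> a \<in> A")
    case True
    have "h \<otimes> a = b \<otimes> (h' \<otimes> a)" using bh ac ball_carrier by (simp add: m_assoc)
    then have "h \<otimes> a \<in> bd A" using bdI[OF bh(1) True] Suc by simp
    then show ?thesis using Suc.prems(1) unfolding r_coset_image by blast
  next
    case False
    then show ?thesis using Suc.IH[OF bh(2)] r_coset_mono[OF ball_Suc_mono, of n a] by blast
  qed
qed

text \<open>Place \<open>m\<close> balls of radius \<open>t\<close> along a geodesic ray with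
  centres \<open>2 * t + 1\<close> apart. They are disjoint, and the last one reaches out to
  \<open>(m - 1) * (2 * t + 1) + t\<close>.\<close>

lemma card_ball_mult_le:
  assumes "(m - 1) * (2 * t + 1) + t \<le> s"
  shows "m * card (ball t) \<le> card (ball s)"
proof -
  obtain y where y: "geodesic_ray y" using ex_geodesic_ray by blast
  define C where "C i = ball t #> y (i * (2 * t + 1))" for i
  have sub: "C i \<subseteq> ball s" if "i < m" for i
  proof
    fix x assume "x \<in> C i"
    then obtain h where "h \<in> ball t" "x = h \<otimes> y (i * (2 * t + 1))"
      unfolding C_def r_coset_image by blast
    then have "x \<in> ball (t + i * (2 * t + 1))" using ball_mult geodesic_ray_ball[OF y] by blast
    moreover have "t + i * (2 * t + 1) \<le> s"
      using mult_le_mono1[of i "m - 1" "2 * t + 1"] assms that by linarith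
    ultimately show "x \<in> ball s" using ball_mono by blast
  qed
  have disj: "C i \<inter> C j = {}" if "i < j" for i j
  proof (rule ccontr)
    assume "C i \<inter> C j \<noteq> {}"
    then obtain h h' where h: "h \<in> ball t" "h' \<in> ball t"
      "h \<otimes> y (i * (2 * t + 1)) = h' \<otimes> y (j * (2 * t + 1))"
      unfolding C_def r_coset_image by blast
    have "y (j * (2 * t + 1)) = (inv h' \<otimes> h) \<otimes> y (i * (2 * t + 1))"
      using h geodesic_ray_carrier[OF y] ball_carrier
      by (metis inv_closed inv_solve_left m_assoc m_closed)
    moreover have "inv h' \<otimes> h \<in> ball (t + t)" using h ball_mult ball_inv by blast
    moreover have "i * (2 * t + 1) + (t + t) < j * (2 * t + 1)"
      using mult_le_mono1[of "Suc i" j "2 * t + 1"] that by simp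
    ultimately show False using geodesic_ray_far[OF y] by blast
  qed
  have "card (\<Union>i<m. C i) = (\<Sum>i<m. card (C i))"
  proof (rule card_UN_disjoint)
    show "\<forall>i\<in>{..<m}. \<forall>j\<in>{..<m}. i \<noteq> j \<longrightarrow> C i \<inter> C j = {}"
      using disj by (metis Int_commute nat_neq_iff)
  qed (auto simp: C_def finite_r_coset finite_ball)
  also have "\<dots> = m * card (ball t)"
    unfolding C_def using geodesic_ray_carrier[OF y] by (simp add: card_r_coset ball_closed)
  finally have "m * card (ball t) = card (\<Union>i<m. C i)" by simp
  also have "\<dots> \<le> card (ball s)" using sub by (intro card_mono finite_ball) auto
  finally show ?thesis .
qed

section \<open>From a small boundary to a plateau of the least boundary\<close>

lemma card_bd_ge_2:
  assumes "finite Y" "Y \<subseteq> carrier G" "Y \<noteq> {}"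
  shows "2 \<le> card (bd Y)"
  using card_bd_ge_twice_normal[OF one_is_normal _ assms] assms by simp

text \<open>Otherwise every point of \<open>A\<close> is within \<open>k - 1\<close> of
  \<open>bd A\<close>, so \<open>k\<close> balls of that radius cover \<open>A\<close>. As
  \<open>2 * k\<close> disjoint ones fit into a ball of radius \<open>4 * k\<^sup>2\<close>, the
  averaging bound applies there and yields \<open>card A \<le> 8 * k ^ 3\<close>.\<close>

lemma ball_subset_of_small_bd:
  assumes A: "finite A" "A \<subseteq> carrier G" and k: "k = card (bd A)" "8 * k ^ 3 < card A"
  shows "\<exists>a\<in>A. ball (k - 1) #> a \<subseteq> A"
proof (rule ccontr)
  assume *: "\<not> ?thesis"
  have ne: "A \<noteq> {}" using k by auto
  have k2: "2 \<le> k" using card_bd_ge_2[OF A ne] k by simp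
  have "A \<subseteq> (\<Union>v\<in>bd A. ball (k - 1) #> v)"
  proof
    fix a assume a: "a \<in> A"
    have ac: "a \<in> carrier G" using a A by auto
    obtain h where "h \<in> ball (k - 1)" "h \<otimes> a \<notin> A"
      using * a unfolding r_coset_image by blast
    then obtain v where v: "v \<in> bd A" "v \<in> ball (k - 1) #> a"
      using exits_through_bd[OF a A(2)] by blast
    then obtain h' where h': "h' \<in> ball (k - 1)" "v = h' \<otimes> a" unfolding r_coset_image by blast
    then have "a = inv h' \<otimes> v" using ac ball_carrier by (simp add: m_assoc[symmetric])
    then have "a \<in> ball (k - 1) #> v" using ball_inv h' unfolding r_coset_image by blast
    then show "a \<in> (\<Union>v\<in>bd A. ball (k - 1) #> v)" using v by blast
  qed
  then have "card A \<le> card (\<Union>v\<in>bd A. ball (k - 1) #> v)"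
    using A by (intro card_mono) (auto simp: finite_bd finite_r_coset finite_ball)
  also have "\<dots> \<le> (\<Sum>v\<in>bd A. card (ball (k - 1) #> v))" by (rule card_UN_le) (simp add: A finite_bd)
  also have "\<dots> = k * card (ball (k - 1))"
    using bd_closed[OF A(2)] by (simp add: card_r_coset ball_closed subsetD k)
  finally have up: "card A \<le> k * card (ball (k - 1))" .
  \<comment> \<open>The left side is \<open>4 k^2 - 3 k\<close>; writing \<open>k = Suc j\<close>
    removes the truncated subtractions.\<close>
  have "(2 * k - 1) * (2 * (k - 1) + 1) + (k - 1) \<le> 4 * k\<^sup>2"
  proof -
    obtain j where "k = Suc j" using k2 by (cases k) auto
    then show ?thesis by (simp add: power2_eq_square algebra_simps)
  qed
  then have "2 * k * card (ball (k - 1)) \<le> card (ball (4 * k\<^sup>2))" by (rule card_ball_mult_le)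
  then have "2 * card A \<le> card (ball (4 * k\<^sup>2))" using up by linarith
  from card_le_of_card_ball_ge[OF A ne this]
  have "card A \<le> 8 * k ^ 3" by (simp add: k power2_eq_square power3_eq_cube mult.assoc)
  then show False using k by simp
qed

lemma ex_plateau:
  assumes A: "finite A" "A \<subseteq> carrier G" and k: "k = card (bd A)" "8 * k ^ 3 < card A"
  obtains R q T where "q \<le> k"
    and "\<And>S. finite S \<Longrightarrow> S \<subseteq> carrier G \<Longrightarrow> ball R \<subseteq> S \<Longrightarrow> q \<le> card (bd S)"
    and "finite T" "T \<subseteq> carrier G" "ball (Suc R) \<subseteq> T" "card (bd T) \<le> q"
proof -
  \<comment> \<open>\<open>P n\<close> says that the least boundary over \<open>ball n\<close> lies
    below the line \<open>n + 2\<close>. It fails at \<open>0\<close> because boundaries have two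
    elements, and holds at \<open>k - 1\<close> by a translate of \<open>A\<close>. If
    \<open>Suc R\<close> is the first success, the minimum is at least \<open>R + 2\<close> over
    \<open>ball R\<close> and at most \<open>R + 2\<close> over \<open>ball (Suc R)\<close>, so
    \<open>q = R + 2\<close>.\<close>
  define P where "P n \<longleftrightarrow> (\<exists>S. finite S \<and> S \<subseteq> carrier G \<and> ball n \<subseteq> S \<and> card (bd S) < n + 2)" for n
  have ne: "A \<noteq> {}" using k by auto
  have k2: "2 \<le> k" using card_bd_ge_2[OF A ne] k by simp
  obtain a where a: "a \<in> A" "ball (k - 1) #> a \<subseteq> A" using ball_subset_of_small_bd[OF A k] by blast
  have ac: "a \<in> carrier G" using a A by auto
  have Pk: "P (k - 1)" unfolding P_def
  proof (intro exI conjI)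
    show "finite (A #> inv a)" using A finite_r_coset by blast
    show "A #> inv a \<subseteq> carrier G" using A ac by (simp add: r_coset_subset_G)
    have "(ball (k - 1) #> a) #> inv a = ball (k - 1)"
      using ac ball_closed by (simp add: coset_mult_assoc)
    then show "ball (k - 1) \<subseteq> A #> inv a" using r_coset_mono[OF a(2), of "inv a"] by simp
    show "card (bd (A #> inv a)) < k - 1 + 2" using A ac k k2 by (simp add: card_bd_r_coset)
  qed
  define n where "n = (LEAST n. P n)"
  have Pn: "P n" unfolding n_def using Pk by (rule LeastI)
  have nk: "n \<le> k - 1" unfolding n_def using Pk by (rule Least_le)
  have "n \<noteq> 0"
  proof
    assume "n = 0"
    with Pn have "P 0" by (simp only:)
    then obtain S where "finite S" "S \<subseteq> carrier G" "ball 0 \<subseteq> S" "card (bd S) < 2"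
      unfolding P_def add_0 by blast
    moreover from this have "S \<noteq> {}" by auto
    ultimately show False using card_bd_ge_2[of S] by linarith
  qed
  then obtain R where R: "n = Suc R" by (cases n) auto
  have "\<not> P R" using not_less_Least[of R P, folded n_def] R by blast
  then have lower: "R + 2 \<le> card (bd S)" if "finite S" "S \<subseteq> carrier G" "ball R \<subseteq> S" for S
    using that unfolding P_def by (meson not_le)
  obtain T where "finite T" "T \<subseteq> carrier G" "ball (Suc R) \<subseteq> T" "card (bd T) < Suc R + 2"
    using Pn unfolding P_def R by blast
  moreover have "R + 2 \<le> k" using nk k2 R by linarith
  ultimately show thesis using that[of "R + 2" R T] lower by auto
qed

section \<open>Sets with finite boundary\<close>

text \<open>\<open>tame S\<close> holds for the sets that are almost invariant under left translation; modulo finite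
  sets they are the clopen sets of ends.\<close>

definition tame :: "'a set \<Rightarrow> bool"
  where "tame S \<longleftrightarrow> S \<subseteq> carrier G \<and> finite (bd S)"

text \<open>A point \<open>x = b \<otimes> s\<close> of \<open>S\<close> with \<open>s\<close>
  outside \<open>S\<close> makes \<open>s = inv b \<otimes> x\<close> a boundary point of
  \<open>S\<close>, by symmetry of \<open>B\<close>; so \<open>x\<close> is one step from
  \<open>bd S\<close>.\<close>

lemma bd_Compl_subset: "S \<subseteq> carrier G \<Longrightarrow> bd (carrier G - S) \<subseteq> B <#> bd S"
proof
  fix x assume S: "S \<subseteq> carrier G" and "x \<in> bd (carrier G - S)"
  then obtain b s where bs: "b \<in> B" "s \<in> carrier G" "s \<notin> S" "x = b \<otimes> s" "x \<in> S"
    by (auto simp: bd_def set_mult_iff)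
  have s: "s = inv b \<otimes> x" using bs by (simp add: m_assoc[symmetric])
  then have "s \<in> bd S" using bdI[OF inv_B[OF bs(1)] bs(5)] bs by auto
  then show "x \<in> B <#> bd S" using bs set_multI by blast
qed

lemma tame_Compl: "tame S \<Longrightarrow> tame (carrier G - S)"
  unfolding tame_def
  using bd_Compl_subset finite_subset finite_set_mult[OF finite_B] by (metis Diff_subset)

lemma bd_Int_subset: "bd (S \<inter> T) \<subseteq> bd S \<union> bd T"
  unfolding bd_def set_mult_def by blast

lemma tame_Int: "tame S \<Longrightarrow> tame T \<Longrightarrow> tame (S \<inter> T)"
  unfolding tame_def using bd_Int_subset[of S T] finite_subset by blast

lemma tame_r_coset: "tame S \<Longrightarrow> g \<in> carrier G \<Longrightarrow> tame (S #> g)"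
  unfolding tame_def by (simp add: bd_r_coset r_coset_subset_G finite_r_coset)

section \<open>Inner boundaries and the separation of sets\<close>

definition inner_bd :: "'a set \<Rightarrow> 'a set"
  where "inner_bd S = {s \<in> S. \<exists>b\<in>B. b \<otimes> s \<notin> S}"

lemma inner_bd_subset: "S \<subseteq> carrier G \<Longrightarrow> inner_bd S \<subseteq> B <#> bd S"
proof
  fix s assume S: "S \<subseteq> carrier G" and "s \<in> inner_bd S"
  then obtain b where b: "s \<in> S" "b \<in> B" "b \<otimes> s \<notin> S" by (auto simp: inner_bd_def)
  have "s = inv b \<otimes> (b \<otimes> s)" using b S by (auto simp: m_assoc[symmetric])
  then show "s \<in> B <#> bd S" using inv_B[OF b(2)] bdI[OF b(2,1,3)] set_multI by metis
qed

lemma tame_inner_bd: "tame S \<Longrightarrow> finite (inner_bd S)"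
  unfolding tame_def using inner_bd_subset finite_subset finite_set_mult[OF finite_B] by metis

lemma inner_bd_r_coset:
  assumes "S \<subseteq> carrier G" "g \<in> carrier G"
  shows "inner_bd (S #> g) = inner_bd S #> g"
proof -
  have "b \<otimes> (s \<otimes> g) \<in> S #> g \<longleftrightarrow> b \<otimes> s \<in> S" if "b \<in> B" "s \<in> S" for b s
    using that assms by (subst mem_r_coset) (auto simp: m_assoc subsetD)
  then show ?thesis unfolding inner_bd_def by (auto simp: r_coset_image)
qed

text \<open>A step out of \<open>P \<inter> Q\<close> would start at a point of
  \<open>inner_bd P\<close> in \<open>Q\<close> or of \<open>inner_bd Q\<close> in \<open>P\<close>.
  So the intersection has empty boundary, and connectedness leaves only the empty set.\<close>

lemma disjoint_of_inner_bd:
  assumes P: "P \<subseteq> carrier G" and Q: "Q \<subseteq> carrier G"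
    and "inner_bd P \<inter> Q = {}" "inner_bd Q \<inter> P = {}" "P \<noteq> carrier G"
  shows "P \<inter> Q = {}"
proof (rule ccontr)
  assume "P \<inter> Q \<noteq> {}"
  moreover have "bd (P \<inter> Q) = {}"
    using assms(3,4) unfolding bd_def set_mult_def inner_bd_def by blast
  ultimately have "P \<inter> Q = carrier G" using connected_carrier[of "P \<inter> Q"] P by blast
  then show False using assms by blast
qed

lemma inner_bd_nonempty:
  assumes "S \<subseteq> carrier G" "S \<noteq> {}" "S \<noteq> carrier G"
  shows "inner_bd S \<noteq> {}"
  using bd_nonempty[OF assms] by (auto simp: bd_def inner_bd_def set_mult_iff)

text \<open>A path inside the ball between \<open>S\<close> and its complement would pass through
  one of the two inner boundaries. Hence all points of the ball lie on the same side as its centre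
  \<open>g\<close>.\<close>

lemma ball_translate_dichotomy:
  assumes S: "S \<subseteq> carrier G" and g: "g \<in> carrier G"
    and disj: "inner_bd S \<inter> (ball n #> g) = {}"
    and meet: "S \<inter> (ball n #> g) \<noteq> {}"
    and disj': "inner_bd (carrier G - S) \<inter> (ball n #> g) = {}"
  shows "ball n #> g \<subseteq> S"
proof -
  have iff: "h \<otimes> g \<in> S \<longleftrightarrow> g \<in> S" if "h \<in> ball m" "m \<le> n" for h m
    using that
  proof (induction m arbitrary: h)
    case 0
    then show ?case using g by simp
  next
    case (Suc m)
    then obtain b h' where bh: "b \<in> B" "h' \<in> ball m" "h = b \<otimes> h'" by (auto simp: set_mult_iff)
    have e: "h \<otimes> g = b \<otimes> (h' \<otimes> g)" using bh g ball_carrier by (simp add: m_assoc)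
    have "h' \<in> ball n" using bh ball_mono Suc.prems Suc_leD by blast
    then have "h' \<otimes> g \<in> ball n #> g" by (auto simp: r_coset_image)
    then have "h' \<otimes> g \<notin> inner_bd S" "h' \<otimes> g \<notin> inner_bd (carrier G - S)" using disj disj' by auto
    moreover have "h \<otimes> g \<in> carrier G" "h' \<otimes> g \<in> carrier G" using bh g ball_carrier by auto
    ultimately have "h \<otimes> g \<in> S \<longleftrightarrow> h' \<otimes> g \<in> S" using bh(1) e by (auto simp: inner_bd_def)
    then show ?case using Suc.IH[OF bh(2)] Suc.prems by simp
  qed
  then show ?thesis using meet by (auto simp: r_coset_image)
qed

end

section \<open>Large sets of small boundary\<close>

text \<open>Since \<open>q\<close> bounds the boundaries from below already over \<open>ball R\<close>, the set \<open>T\<close> can be united with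
  its translate by a generator: both contain \<open>ball R\<close>, so by submodularity the union still has
  boundary at most \<open>q\<close>.\<close>

locale plateau = cayley_graph +
  fixes R q :: nat and T :: "'a set"
  assumes q_le: "\<And>S. finite S \<Longrightarrow> S \<subseteq> carrier G \<Longrightarrow> ball R \<subseteq> S \<Longrightarrow> q \<le> card (bd S)"
    and T: "finite T" "T \<subseteq> carrier G" "ball (Suc R) \<subseteq> T" "card (bd T) \<le> q"
begin

text \<open>Translated back by \<open>x\<close>, the intersection falls under \<open>q_le\<close>,
  so its boundary has at least \<open>q\<close> elements; submodularity leaves at most
  \<open>q\<close> for the union.\<close>

lemma card_bd_Un_le:
  assumes S: "finite S" "S \<subseteq> carrier G" "card (bd S) \<le> q"
    and S': "finite S'" "S' \<subseteq> carrier G" "card (bd S') \<le> q"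
    and x: "x \<in> carrier G" "ball R #> x \<subseteq> S \<inter> S'"
  shows "card (bd (S \<union> S')) \<le> q"
proof -
  have c: "S \<inter> S' \<subseteq> carrier G" using S by blast
  have "(ball R #> x) #> inv x = ball R" using x ball_closed by (simp add: coset_mult_assoc)
  then have "ball R \<subseteq> (S \<inter> S') #> inv x" using r_coset_mono[OF x(2), of "inv x"] by simp
  moreover have "(S \<inter> S') #> inv x \<subseteq> carrier G" using c x by (simp add: r_coset_subset_G)
  moreover have "finite ((S \<inter> S') #> inv x)" using S finite_r_coset by blast
  ultimately have "q \<le> card (bd ((S \<inter> S') #> inv x))" using q_le by blast
  then have "q \<le> card (bd (S \<inter> S'))" using card_bd_r_coset[OF c, of "inv x"] x by simp
  then show ?thesis using card_bd_submodular[OF S(1) S'(1) S(2) S'(2)] S S' by linarith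
qed

lemma card_bd_UN_translates_le:
  assumes S: "finite S" "S \<subseteq> carrier G" "card (bd S) \<le> q"
    and M: "finite M" "M \<noteq> {}" "M \<subseteq> carrier G"
    and ball: "\<And>g. g \<in> M \<Longrightarrow> ball R \<subseteq> S #> g"
  shows "card (bd (\<Union>g\<in>M. S #> g)) \<le> q"
  using M ball
proof (induction rule: finite_ne_induct)
  case (singleton g)
  then show ?case using S by (simp add: card_bd_r_coset)
next
  case (insert g F)
  have "card (bd ((S #> g) \<union> (\<Union>g\<in>F. S #> g))) \<le> q"
  proof (rule card_bd_Un_le)
    show "(\<Union>g\<in>F. S #> g) \<subseteq> carrier G"
      using insert.prems(1) r_coset_subset_G[OF S(2)] by (intro UN_least) blast
    show "card (bd (S #> g)) \<le> q" using insert S by (simp add: card_bd_r_coset)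
    show "ball R #> \<one> \<subseteq> (S #> g) \<inter> (\<Union>g\<in>F. S #> g)"
      using insert ball_closed by (auto simp: subset_eq)
  qed (use insert S finite_r_coset r_coset_subset_G in auto)
  then show ?case by simp
qed

text \<open>The union of the translates of \<open>S\<close> by generators contains a ball of radius
  one larger. Each translate loses at most one unit of radius about \<open>\<one>\<close>, hence
  still contains \<open>ball R\<close>.\<close>

lemma ex_large:
  "\<exists>S. finite S \<and> S \<subseteq> carrier G \<and> ball (Suc R + p) \<subseteq> S \<and> card (bd S) \<le> q"
proof (induction p)
  case 0
  then show ?case using T by auto
next
  case (Suc p)
  then obtain S where S: "finite S" "S \<subseteq> carrier G" "ball (Suc R + p) \<subseteq> S" "card (bd S) \<le> q"
    by blast
  have sub: "ball (R + p) \<subseteq> S #> b" if b: "b \<in> B" for b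
  proof
    fix x assume x: "x \<in> ball (R + p)"
    have "inv b \<in> ball (Suc 0)" using inv_B[OF b] ball_1 by simp
    then have "x \<otimes> inv b \<in> ball (R + p + Suc 0)" using x ball_mult by blast
    then show "x \<in> S #> b" using S b x ball_carrier by (subst mem_r_coset) auto
  qed
  have "card (bd (\<Union>b\<in>B. S #> b)) \<le> q"
  proof (rule card_bd_UN_translates_le)
    show "ball R \<subseteq> S #> b" if "b \<in> B" for b
      using sub[OF that] ball_mono[of R "R + p"] by auto
  qed (use S finite_B one_B B_closed in auto)
  moreover have "ball (Suc R + Suc p) \<subseteq> (\<Union>b\<in>B. S #> b)"
  proof -
    have "ball (Suc R + Suc p) = ball (Suc R + p) <#> ball (Suc 0)" by (subst ball_add) simp
    then have e: "ball (Suc R + Suc p) = ball (Suc R + p) <#> B" by (simp only: ball_1)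
    show ?thesis unfolding e using S(3) unfolding set_mult_def r_coset_def by blast
  qed
  moreover have "(\<Union>b\<in>B. S #> b) \<subseteq> carrier G"
    using r_coset_subset_G[OF S(2)] B_closed by blast
  ultimately show ?case using S finite_B finite_r_coset by (intro exI[of _ "\<Union>b\<in>B. S #> b"]) auto
qed

lemma ex_large_superset:
  assumes "finite F" "F \<subseteq> carrier G"
  obtains S where "finite S" "S \<subseteq> carrier G" "F \<subseteq> S" "card (bd S) \<le> q"
proof -
  obtain p where "F \<subseteq> ball p" using finite_subset_ball assms by blast
  then have "F \<subseteq> ball (Suc R + p)" using ball_mono[of p "Suc R + p"] by auto
  then show thesis using that ex_large[of p] by blast
qed

text \<open>For \<open>S\<close> so large that all its translates by \<open>N\<close> contain
  \<open>ball R\<close>, their union \<open>Y\<close> keeps a boundary of size at most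
  \<open>q\<close>. It is right invariant under \<open>N\<close>, so its boundary contains two
  cosets of \<open>N\<close>.\<close>

lemma card_normal_le:
  assumes N: "N \<lhd> G" "finite N"
  shows "2 * card N \<le> q"
proof -
  interpret N: normal N G by fact
  obtain p where p: "N \<subseteq> ball p" using finite_subset_ball N N.subset by blast
  obtain S where S: "finite S" "S \<subseteq> carrier G" "ball (Suc R + p) \<subseteq> S" "card (bd S) \<le> q"
    using ex_large by blast
  define Y where "Y = (\<Union>n\<in>N. S #> n)"
  have sub: "ball R \<subseteq> S #> n" if n: "n \<in> N" for n
  proof
    fix x assume x: "x \<in> ball R"
    have "inv n \<in> ball p" using n p ball_inv by blast
    then have "x \<otimes> inv n \<in> ball (R + p)" using x ball_mult by blast
    then have "x \<otimes> inv n \<in> S" using S(3) ball_mono[of "R + p" "Suc R + p"] by auto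
    then show "x \<in> S #> n" using S n x ball_carrier N.subset by (subst mem_r_coset) auto
  qed
  have N_ne: "N \<noteq> {}" using N.one_closed by blast
  have bdY: "card (bd Y) \<le> q" unfolding Y_def
    by (rule card_bd_UN_translates_le) (use S N N.subset N_ne sub in auto)
  have "2 * card N \<le> card (bd Y)"
  proof (rule card_bd_ge_twice_normal[OF N])
    show "finite Y" unfolding Y_def using N S finite_r_coset by blast
    show "Y \<subseteq> carrier G" unfolding Y_def using r_coset_subset_G[OF S(2)] N.subset by blast
    show "Y \<noteq> {}" unfolding Y_def using sub one_ball N.one_closed by blast
    show "Y #> n = Y" if n: "n \<in> N" for n
    proof -
      have nc: "n \<in> carrier G" using n N.subset by blast
      have "Y #> n = (\<Union>m\<in>N. (S #> m) #> n)" unfolding Y_def by (auto simp: r_coset_image)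
      also have "\<dots> = (\<Union>m\<in>N. S #> (m \<otimes> n))"
        using S nc N.subset by (intro SUP_cong) (auto simp: coset_mult_assoc subsetD)
      also have "\<dots> = (\<Union>m \<in> (\<lambda>m. m \<otimes> n) ` N. S #> m)" by auto
      also have "(\<lambda>m. m \<otimes> n) ` N = N"
        using N.rcos_const[OF is_group n] unfolding r_coset_image .
      finally show ?thesis unfolding Y_def .
    qed
  qed
  then show ?thesis using bdY by linarith
qed

text \<open>Let a finite \<open>Y\<close> with small boundary contain all boundaries of members of
  \<open>F\<close>. A step out of \<open>S - Y\<close> must then enter \<open>Y\<close>, so
  \<open>bd Y\<close> has a point in each member, and disjointness makes these points
  distinct.\<close>

lemma card_disjoint_tame_le:
  assumes F: "finite F" "\<And>S. S \<in> F \<Longrightarrow> tame S \<and> infinite S" "disjoint F"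
  shows "card F \<le> q"
proof -
  have "finite (\<Union>S\<in>F. bd S)" "(\<Union>S\<in>F. bd S) \<subseteq> carrier G"
    using F unfolding tame_def using bd_closed by blast+
  \<comment> \<open>Including \<open>\<one>\<close> keeps \<open>S - Y\<close> from being the whole
    group.\<close>
  then obtain Y where Y: "finite Y" "Y \<subseteq> carrier G" "(\<Union>S\<in>F. bd S) \<union> {\<one>} \<subseteq> Y" "card (bd Y) \<le> q"
    using ex_large_superset[of "(\<Union>S\<in>F. bd S) \<union> {\<one>}"] by auto
  have "\<exists>u. u \<in> bd Y \<inter> S" if S: "S \<in> F" for S
  proof -
    have c: "S - Y \<subseteq> carrier G" using F(2)[OF S] by (auto simp: tame_def)
    have ne: "S - Y \<noteq> {}" using F(2)[OF S] Y by (metis finite.emptyI finite_Diff2)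
    have ne': "S - Y \<noteq> carrier G" using Y by auto
    obtain u where u: "u \<in> inner_bd (S - Y)" using inner_bd_nonempty[OF c ne ne'] by blast
    then obtain b where b: "u \<in> S" "u \<notin> Y" "b \<in> B" "b \<otimes> u \<notin> S - Y" by (auto simp: inner_bd_def)
    have uc: "u \<in> carrier G" using b c by blast
    have "b \<otimes> u \<in> Y" using b bdI[OF b(3) b(1)] Y(3) S by blast
    moreover have "u = inv b \<otimes> (b \<otimes> u)" using b uc by (simp add: m_assoc[symmetric])
    ultimately have "u \<in> bd Y" using bdI[OF inv_B[OF b(3)], of "b \<otimes> u" Y] b by simp
    then show ?thesis using b by blast
  qed
  then obtain f where f: "\<And>S. S \<in> F \<Longrightarrow> f S \<in> bd Y \<inter> S" by metis
  have "inj_on f F"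
  proof (rule inj_onI)
    fix S S' assume "S \<in> F" "S' \<in> F" "f S = f S'"
    then show "S = S'" using f F(3) unfolding disjoint_def by (metis IntE disjoint_iff)
  qed
  then have "card F \<le> card (bd Y)" using f by (intro card_inj_on_le) (auto simp: finite_bd Y)
  then show ?thesis using Y by linarith
qed

lemma ex_end:
  obtains U where "tame U" "infinite U" "infinite (carrier G - U)"
proof -
  obtain y where y: "geodesic_ray y" using ex_geodesic_ray by blast
  have yc: "y n \<in> carrier G" for n using geodesic_ray_carrier[OF y] .
  \<comment> \<open>Translates of \<open>T\<close> are united along the ray. Finite stages have
    boundary at most \<open>q\<close>, and this passes to the limit \<open>U\<close>.\<close>
  define H where "H n = (\<Union>i\<le>n. T #> y i)" for n
  define U where "U = (\<Union>n. H n)"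
  have Tc: "T #> y i \<subseteq> carrier G" for i using T yc by (simp add: r_coset_subset_G)
  have Hc: "H n \<subseteq> carrier G" and Hf: "finite (H n)" for n
    unfolding H_def using Tc T finite_r_coset by auto
  have Hmono: "H m \<subseteq> H n" if "m \<le> n" for m n unfolding H_def using that by fastforce
  have bdH: "card (bd (H n)) \<le> q" for n
  proof (induction n)
    case 0
    then show ?case unfolding H_def using T yc by (simp add: card_bd_r_coset)
  next
    case (Suc n)
    have e: "H (Suc n) = H n \<union> (T #> y (Suc n))" unfolding H_def by (auto simp: atMost_Suc)
    obtain b where b: "b \<in> B" "y (Suc n) = b \<otimes> y n" using y unfolding geodesic_ray_def by blast
    \<comment> \<open>One step along the ray costs one unit of radius; this is where
      \<open>T\<close> containing \<open>ball (Suc R)\<close>, not just \<open>ball R\<close>,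
      matters.\<close>
    have "ball R #> y (Suc n) \<subseteq> ball (Suc R) #> y n"
    proof
      fix x assume "x \<in> ball R #> y (Suc n)"
      then obtain h where h: "h \<in> ball R" "x = h \<otimes> y (Suc n)" unfolding r_coset_image by blast
      have "x = (h \<otimes> b) \<otimes> y n" using h b yc ball_carrier by (simp add: m_assoc)
      moreover have "h \<otimes> b \<in> ball (Suc R)" using ball_mult[of h R b "Suc 0"] h b ball_1 by simp
      ultimately show "x \<in> ball (Suc R) #> y n" unfolding r_coset_image by blast
    qed
    also have "\<dots> \<subseteq> H n" unfolding H_def using r_coset_mono[OF T(3)] by blast
    finally have 1: "ball R #> y (Suc n) \<subseteq> H n" .
    have "ball R \<subseteq> T" using T(3) ball_Suc_mono by blast
    then have 2: "ball R #> y (Suc n) \<subseteq> T #> y (Suc n)" by (rule r_coset_mono)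
    show ?case unfolding e
      by (rule card_bd_Un_le[OF Hf Hc Suc, where x = "y (Suc n)"])
        (use T Tc finite_r_coset yc card_bd_r_coset 1 2 in auto)
  qed
  have Uc: "U \<subseteq> carrier G" unfolding U_def using Hc by blast
  have "finite (bd U)"
  proof (rule ccontr)
    assume "infinite (bd U)"
    \<comment> \<open>Any \<open>q + 1\<close> points of \<open>bd U\<close> already lie in the
      boundary of one stage \<open>H m\<close>.\<close>
    then obtain D where D: "D \<subseteq> bd U" "finite D" "card D = Suc q"
      using infinite_arbitrarily_large by blast
    have "\<exists>n. v \<in> B <#> H n" if v: "v \<in> D" for v
      using D(1) v unfolding bd_def U_def set_mult_def by blast
    then obtain n where n: "\<And>v. v \<in> D \<Longrightarrow> v \<in> B <#> H (n v)" by metis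
    define m where "m = Max (n ` D)"
    have "D \<subseteq> bd (H m)"
    proof
      fix v assume v: "v \<in> D"
      have "n v \<le> m" unfolding m_def using D v by simp
      then have "v \<in> B <#> H m" using n[OF v] Hmono mono_set_mult[of B B "H (n v)" "H m"] by blast
      moreover have "v \<notin> H m" using v D(1) unfolding bd_def U_def by blast
      ultimately show "v \<in> bd (H m)" by (simp add: bd_def)
    qed
    then have "Suc q \<le> card (bd (H m))" using D card_mono[OF finite_bd[OF Hf]] by metis
    then show False using bdH[of m] by simp
  qed
  then have tame: "tame U" using Uc by (simp add: tame_def)
  have yU: "y n \<in> U" for n
  proof -
    have "\<one> \<in> T" using T(3) one_ball by blast
    then have "\<one> \<otimes> y n \<in> T #> y n" unfolding r_coset_image by (rule imageI)
    then show ?thesis unfolding U_def H_def using yc[of n] by auto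
  qed
  have "inj y"
  proof (rule injI)
    fix m n assume "y m = y n"
    then show "m = n"
      using geodesic_ray_ball[OF y] y unfolding geodesic_ray_def by (metis nat_neq_iff)
  qed
  then have inf: "infinite U" using yU finite_subset[of "range y" U] range_inj_infinite by blast
  text \<open>If the complement were finite, the group would be a neighbourhood of a one-sided ray; but
    around \<open>y n\<close> the ray contains two points at distance \<open>n\<close> from it and \<open>2n\<close> apart.\<close>
  have "infinite (carrier G - U)"
  proof
    assume "finite (carrier G - U)"
    then obtain d where d: "T \<union> (carrier G - U) \<subseteq> ball d"
      using finite_subset_ball[of "T \<union> (carrier G - U)"] T by auto
    \<comment> \<open>Points of \<open>U\<close> are near the ray through \<open>T\<close>, the
      others through \<open>y 0 = \<one>\<close>.\<close>
    have near: "\<exists>i h. h \<in> ball d \<and> x = h \<otimes> y i" if x: "x \<in> carrier G" for x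
    proof (cases "x \<in> U")
      case True
      then show ?thesis using d unfolding U_def H_def r_coset_image by blast
    next
      case False
      then have "x \<in> ball d \<and> x = x \<otimes> y 0" using d x y unfolding geodesic_ray_def by auto
      then show ?thesis by blast
    qed
    have iball: "y i \<in> ball m \<Longrightarrow> i \<le> m" for i m
      using y unfolding geodesic_ray_def by (meson not_le)
    have step: "\<exists>h\<in>ball k. y (i + k) = h \<otimes> y i" for i k
    proof (induction k)
      case 0
      then show ?case using yc by auto
    next
      case (Suc k)
      then obtain h where h: "h \<in> ball k" "y (i + k) = h \<otimes> y i" by blast
      obtain b where b: "b \<in> B" "y (Suc (i + k)) = b \<otimes> y (i + k)"
        using y unfolding geodesic_ray_def by blast
      have "y (i + Suc k) = (b \<otimes> h) \<otimes> y i" using h b yc ball_carrier by (simp add: m_assoc)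
      then show ?case using ball_SucI[OF b(1) h(1)] by blast
    qed
    \<comment> \<open>\<open>p\<close> and \<open>r\<close> are \<open>y 0\<close> and
      \<open>y (2n)\<close> after moving \<open>y n\<close> to \<open>\<one>\<close>. They are
      within \<open>d\<close> of ray points \<open>y i\<close> and \<open>y j\<close> whose indices
      differ from \<open>n\<close> by at most \<open>d\<close>. So \<open>p\<close> and
      \<open>r\<close> are at distance at most \<open>d + 2d + d\<close>, against their true
      distance \<open>2n\<close>; \<open>n = 4d + 1\<close> exceeds this bound.\<close>
    define n where "n = Suc (4 * d)"
    define p where "p = y 0 \<otimes> inv (y n)"
    define r where "r = y (n + n) \<otimes> inv (y n)"
    have pn: "p \<in> ball n" unfolding p_def using ball_inv[OF geodesic_ray_ball[OF y]] y yc
      by (simp add: geodesic_ray_def)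
    obtain h where h: "h \<in> ball n" "y (n + n) = h \<otimes> y n" using step by blast
    have rh: "r = h" unfolding r_def h(2) using h yc ball_carrier by (simp add: m_assoc)
    have pr: "r \<otimes> inv p = y (n + n)"
      unfolding r_def p_def using y yc by (simp add: geodesic_ray_def m_assoc)
    have pc: "p \<in> carrier G" and rc: "r \<in> carrier G" unfolding p_def r_def using yc by auto
    obtain i e where ie: "e \<in> ball d" "p = e \<otimes> y i" using near[OF pc] by blast
    obtain j f where jf: "f \<in> ball d" "r = f \<otimes> y j" using near[OF rc] by blast
    have ec: "e \<in> carrier G" "f \<in> carrier G" using ie jf ball_carrier by auto
    have bnd: "i \<le> d + n" "j \<le> d + n"
    proof -
      have "y i = inv e \<otimes> p" using ie ec yc by (simp add: m_assoc[symmetric])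
      then show "i \<le> d + n" using iball ball_mult[OF ball_inv[OF ie(1)] pn] by simp
      have "y j = inv f \<otimes> r" using jf ec yc by (simp add: m_assoc[symmetric])
      then show "j \<le> d + n" using iball ball_mult[OF ball_inv[OF jf(1)] h(1)] rh by simp
    qed
    have bnd': "n \<le> d + i" "n \<le> d + j"
    proof -
      have "inv p = y n" unfolding p_def using y yc by (simp add: geodesic_ray_def)
      moreover have "p \<in> ball (d + i)" using ie ball_mult geodesic_ray_ball[OF y] by blast
      ultimately show "n \<le> d + i" using iball ball_inv by metis
      have "r \<in> ball (d + j)" unfolding jf(2) by (rule ball_mult[OF jf(1) geodesic_ray_ball[OF y]])
      then have "r \<otimes> y n \<in> ball (d + j + n)" by (rule ball_mult[OF _ geodesic_ray_ball[OF y]])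
      then have "y (n + n) \<in> ball (d + j + n)" unfolding h(2) rh .
      from iball[OF this] show "n \<le> d + j" by simp
    qed
    have close: "\<exists>g\<in>ball (2 * d). y j = g \<otimes> y i"
    proof (cases "i \<le> j")
      case True
      then obtain g where g: "g \<in> ball (j - i)" "y j = g \<otimes> y i" using step[of "j - i" i] by auto
      have "j - i \<le> 2 * d" using bnd bnd' by linarith
      then show ?thesis using g ball_mono by blast
    next
      case False
      then obtain g where g: "g \<in> ball (i - j)" "y i = g \<otimes> y j" using step[of "i - j" j] by auto
      have "i - j \<le> 2 * d" using bnd bnd' by linarith
      then have "inv g \<in> ball (2 * d)" using g ball_mono ball_inv by blast
      moreover have "y j = inv g \<otimes> y i" using g yc ball_carrier by (simp add: m_assoc[symmetric])
      ultimately show ?thesis by blast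
    qed
    then obtain g where g: "g \<in> ball (2 * d)" "y j = g \<otimes> y i" by blast
    have gc: "g \<in> carrier G" using g ball_carrier by blast
    have "y (n + n) = f \<otimes> (g \<otimes> inv e)"
      unfolding pr[symmetric] ie(2) jf(2) g(2) using ec gc yc
      by (simp add: inv_mult_group m_assoc[symmetric]) (simp add: m_assoc)
    moreover have "f \<otimes> (g \<otimes> inv e) \<in> ball (d + (2 * d + d))"
      using ball_mult[OF jf(1) ball_mult[OF g(1) ball_inv[OF ie(1)]]] .
    ultimately have "y (n + n) \<in> ball (d + (2 * d + d))" by (simp only:)
    from iball[OF this] show False by (simp add: n_def)
  qed
  then show thesis using that tame inf by blast
qed

end

section \<open>Cyclic and dihedral quotients\<close>

text \<open>\<open>K\<close> plays the role of the subgroup that fixes both ends, and \<open>\<phi>\<close> that of the displacement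
  along the axis.\<close>

locale reflected_hom = group G for G :: "('a, 'b) monoid_scheme" (structure) +
  fixes K :: "'a set" and \<phi> :: "'a \<Rightarrow> int"
  assumes subgroup_K: "subgroup K G"
    and mult_notin: "g \<in> carrier G - K \<Longrightarrow> h \<in> carrier G - K \<Longrightarrow> g \<otimes> h \<in> K"
    and \<phi>_mult: "g \<in> K \<Longrightarrow> h \<in> K \<Longrightarrow> \<phi> (g \<otimes> h) = \<phi> g + \<phi> h"
    and \<phi>_conj: "g \<in> K \<Longrightarrow> h \<in> carrier G - K \<Longrightarrow> h \<otimes> g \<otimes> inv h \<in> K \<and> \<phi> (h \<otimes> g \<otimes> inv h) = - \<phi> g"
    and finite_kernel: "finite {g \<in> K. \<phi> g = 0}"
    and infinite_carrier: "infinite (carrier G)"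
begin

sublocale K: subgroup K G by (rule subgroup_K)

definition N :: "'a set"
  where "N = {g \<in> K. \<phi> g = 0}"

lemma K_carrier [simp]: "g \<in> K \<Longrightarrow> g \<in> carrier G"
  using K.subset by blast

lemma \<phi>_one [simp]: "\<phi> \<one> = 0"
  using \<phi>_mult[of \<one> \<one>] by simp

lemma \<phi>_inv: "g \<in> K \<Longrightarrow> \<phi> (inv g) = - \<phi> g"
  using \<phi>_mult[of "inv g" g] by simp

lemma \<phi>_int_pow:
  assumes "g \<in> K"
  shows "\<phi> (g [^] (m :: int)) = m * \<phi> g"
proof -
  have nat: "g [^] n \<in> K \<and> \<phi> (g [^] n) = int n * \<phi> g" for n :: nat
    by (induction n) (use assms in \<open>auto simp: \<phi>_mult algebra_simps\<close>)
  show ?thesis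
  proof (cases m rule: int_cases2)
    case (nonneg n)
    then show ?thesis using nat[of n] by (simp add: int_pow_int)
  next
    case (nonpos n)
    then show ?thesis using nat[of n] assms by (simp add: int_pow_neg_int \<phi>_inv)
  qed
qed

lemma int_pow_K: "g \<in> K \<Longrightarrow> g [^] (m :: int) \<in> K"
  by (rule subgroup_int_pow_closed[OF subgroup_K])

lemma mult_notin_K: "g \<in> K \<Longrightarrow> h \<in> carrier G - K \<Longrightarrow> g \<otimes> h \<in> carrier G - K"
proof
  assume g: "g \<in> K" and h: "h \<in> carrier G - K"
  show "g \<otimes> h \<in> carrier G" using g h by simp
  show "g \<otimes> h \<notin> K"
  proof
    assume "g \<otimes> h \<in> K"
    then have "inv g \<otimes> (g \<otimes> h) \<in> K" using g by blast
    then show False using g h by (simp add: m_assoc[symmetric])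
  qed
qed

text \<open>Conjugation by an element of \<open>K\<close> preserves \<open>\<phi>\<close> and by any
  other element negates it; zero survives both.\<close>

lemma normal_N: "N \<lhd> G"
proof -
  have "subgroup N G"
    by (rule subgroupI) (auto simp: N_def \<phi>_mult \<phi>_inv intro: exI[of _ \<one>])
  moreover have "x \<otimes> n \<otimes> inv x \<in> N" if x: "x \<in> carrier G" and n: "n \<in> N" for x n
  proof (cases "x \<in> K")
    case True
    then show ?thesis using n by (simp add: N_def \<phi>_mult \<phi>_inv)
  next
    case False
    then show ?thesis using \<phi>_conj[of n x] x n by (simp add: N_def)
  qed
  ultimately show ?thesis using normal_inv_iff by blast
qed

sublocale N: normal N G by (rule normal_N)

lemma finite_N: "finite N"
  unfolding N_def by (rule finite_kernel)

lemma N_coset_eq_iff: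
  assumes "x \<in> carrier G" "y \<in> carrier G"
  shows "N #> x = N #> y \<longleftrightarrow> x \<otimes> inv y \<in> N"
  using assms N.rcos_module[OF is_group, of y x] N.subgroup_axioms
  by (metis rcos_self repr_independence)

lemma N_coset_eq_K: "x \<in> K \<Longrightarrow> y \<in> K \<Longrightarrow> \<phi> x = \<phi> y \<Longrightarrow> N #> x = N #> y"
  by (subst N_coset_eq_iff) (auto simp: N_def \<phi>_mult \<phi>_inv)

text \<open>\<open>\<phi>\<close> carries information only on \<open>K\<close>, so elements outside
  are compared after multiplication by a common \<open>h\<close> outside.\<close>

lemma N_coset_eq_notin_K:
  assumes "x \<in> carrier G - K" "y \<in> carrier G - K" "h \<in> carrier G - K" "\<phi> (x \<otimes> h) = \<phi> (y \<otimes> h)"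
  shows "N #> x = N #> y"
proof -
  have K: "x \<otimes> h \<in> K" "y \<otimes> h \<in> K" using assms mult_notin by blast+
  have "x \<otimes> inv y = (x \<otimes> h) \<otimes> inv (y \<otimes> h)"
    using assms by (simp add: inv_mult_group m_assoc) (simp add: m_assoc[symmetric])
  moreover have "(x \<otimes> h) \<otimes> inv (y \<otimes> h) \<in> N"
    using K assms(4) unfolding N_def by (simp add: \<phi>_mult \<phi>_inv del: m_closed)
  ultimately show ?thesis using assms by (subst N_coset_eq_iff) auto
qed

text \<open>If \<open>\<phi>\<close> vanished on \<open>K\<close>, then \<open>K\<close> would equal
  its finite kernel, and its complement, which right translation injects into \<open>K\<close>,
  would be finite too. Division with remainder by the least positive value gives the
  generator.\<close>

lemma ex_generator:
  obtains g where "g \<in> K" "\<phi> g > 0" "\<And>x. x \<in> K \<Longrightarrow> \<exists>m. \<phi> x = m * \<phi> g"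
proof -
  have "\<exists>g\<in>K. \<phi> g \<noteq> 0"
  proof (rule ccontr)
    assume "\<not> ?thesis"
    then have "K \<subseteq> {g \<in> K. \<phi> g = 0}" by blast
    then have fin: "finite K" using finite_kernel finite_subset by blast
    have "finite (carrier G - K)"
    proof (cases "carrier G - K = {}")
      case False
      then obtain h where h: "h \<in> carrier G - K" by blast
      have "(\<lambda>x. x \<otimes> h) ` (carrier G - K) \<subseteq> K" using h mult_notin by blast
      moreover have "inj_on (\<lambda>x. x \<otimes> h) (carrier G - K)" using h by (auto simp: inj_on_def)
      ultimately show ?thesis using fin inj_on_finite by blast
    qed (simp only: finite.emptyI)
    then show False using fin infinite_carrier by simp
  qed
  then obtain g0 where "g0 \<in> K" "\<phi> g0 \<noteq> 0" by blast
  then have "\<exists>n. 0 < n \<and> (\<exists>g\<in>K. \<phi> g = int n)"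
    using \<phi>_inv[of g0] by (intro exI[of _ "nat \<bar>\<phi> g0\<bar>"]) (auto simp: abs_if)
  then have least: "0 < (LEAST n. 0 < n \<and> (\<exists>g\<in>K. \<phi> g = int n)) \<and>
      (\<exists>g\<in>K. \<phi> g = int (LEAST n. 0 < n \<and> (\<exists>g\<in>K. \<phi> g = int n)))" by (rule LeastI_ex)
  define d where "d = (LEAST n. 0 < n \<and> (\<exists>g\<in>K. \<phi> g = int n))"
  obtain g where g: "g \<in> K" "\<phi> g = int d" "0 < d" using least unfolding d_def by blast
  have "\<exists>m. \<phi> x = m * \<phi> g" if x: "x \<in> K" for x
  proof -
    define m where "m = \<phi> x div int d"
    define z where "z = x \<otimes> inv (g [^] m)"
    have zK: "z \<in> K" unfolding z_def using x g int_pow_K by simp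
    have "\<phi> z = \<phi> x - m * int d"
      unfolding z_def using x g int_pow_K by (simp add: \<phi>_mult \<phi>_inv \<phi>_int_pow)
    then have z: "\<phi> z = \<phi> x mod int d" unfolding m_def by (simp add: minus_div_mult_eq_mod)
    have "\<phi> z = 0"
    proof (rule ccontr)
      assume "\<phi> z \<noteq> 0"
      then have "0 < nat (\<phi> z)" "nat (\<phi> z) < d" "\<phi> z = int (nat (\<phi> z))"
        using z g(3) pos_mod_sign[of "int d" "\<phi> x"] pos_mod_bound[of "int d" "\<phi> x"] by linarith+
      then show False using zK not_less_Least[of "nat (\<phi> z)" "\<lambda>n. 0 < n \<and> (\<exists>g\<in>K. \<phi> g = int n)"]
        unfolding d_def by metis
    qed
    then show ?thesis using \<open>\<phi> z = \<phi> x - m * int d\<close> g by auto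
  qed
  then show thesis using that[of g] g by simp
qed

lemma cyclic_quotient:
  assumes "K = carrier G"
  shows "cyclic_group (G Mod N)"
proof -
  obtain g where g: "g \<in> K" "\<phi> g > 0" "\<And>x. x \<in> K \<Longrightarrow> \<exists>m. \<phi> x = m * \<phi> g"
    using ex_generator by blast
  interpret Q: group "G Mod N" by (rule N.factorgroup_is_group)
  have gQ: "N #> g \<in> carrier (G Mod N)" using g by (auto simp: FactGroup_def RCOSETS_def)
  have "carrier (G Mod N) = range (\<lambda>n::int. (N #> g) [^]\<^bsub>G Mod N\<^esub> n)"
  proof (intro equalityI subsetI)
    fix Z
    assume "Z \<in> carrier (G Mod N)"
    then obtain x where x: "x \<in> carrier G" "Z = N #> x" by (auto simp: FactGroup_def RCOSETS_def)
    then obtain m where "\<phi> x = m * \<phi> g" using g(3) assms by blast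
    moreover have "x \<in> K" using x assms by blast
    ultimately have "N #> x = N #> (g [^] m)"
      using g int_pow_K by (intro N_coset_eq_K) (simp_all add: \<phi>_int_pow)
    then have "Z = N #> (g [^] m)" using x by (simp only:)
    then show "Z \<in> range (\<lambda>n::int. (N #> g) [^]\<^bsub>G Mod N\<^esub> n)"
      using g by (simp add: N.FactGroup_int_pow)
  next
    fix Z
    assume "Z \<in> range (\<lambda>n::int. (N #> g) [^]\<^bsub>G Mod N\<^esub> n)"
    then show "Z \<in> carrier (G Mod N)" using gQ by auto
  qed
  then show ?thesis unfolding Q.cyclic_group using gQ by blast
qed

text \<open>With \<open>h\<close> outside \<open>K\<close> as reflection, \<open>(a, s)\<close> is
  sent to the coset of \<open>g [^] a\<close>, times \<open>h\<close> if \<open>s\<close> holds. The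
  quotient is the infinite dihedral group, \<open>dihedral_group 0\<close>.\<close>

lemma dihedral_quotient:
  assumes "K \<noteq> carrier G"
  shows "is_dihedral (G Mod N)"
proof -
  obtain g where g: "g \<in> K" "\<phi> g > 0" "\<And>x. x \<in> K \<Longrightarrow> \<exists>m. \<phi> x = m * \<phi> g"
    using ex_generator by blast
  obtain h where h: "h \<in> carrier G - K" using assms K.subset by blast
  have hc: "h \<in> carrier G" and gc: "g \<in> carrier G" using h g by auto
  have hh: "h \<otimes> h \<in> K" using h mult_notin by blast
  \<comment> \<open>Conjugation by \<open>h\<close> fixes \<open>h \<otimes> h\<close> but negates
    its \<open>\<phi>\<close>.\<close>
  have \<phi>hh: "\<phi> (h \<otimes> h) = 0"
  proof -
    have "h \<otimes> (h \<otimes> h) \<otimes> inv h = h \<otimes> h" using hc by (simp add: m_assoc)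
    then show ?thesis using \<phi>_conj[OF hh h] by simp
  qed
  define e where "e = (\<lambda>(a :: int, s). g [^] a \<otimes> (if s then h else \<one>))"
  have eF: "e (a, False) = g [^] a" and eT: "e (a, True) = g [^] a \<otimes> h" for a
    using gc by (simp_all add: e_def)
  have ec: "e x \<in> carrier G" for x using gc hc by (cases x) (simp add: e_def)
  have eFK: "e (a, False) \<in> K" for a unfolding eF using g int_pow_K by blast
  have eTK: "e (a, True) \<in> carrier G - K" for a unfolding eT using g int_pow_K mult_notin_K h by blast
  have \<phi>F: "\<phi> (e (a, False)) = a * \<phi> g" for a unfolding eF using g by (simp add: \<phi>_int_pow)
  have \<phi>T: "\<phi> (e (a, True) \<otimes> h) = a * \<phi> g" for a
    unfolding eT using g hh hc gc int_pow_K \<phi>hh by (simp add: \<phi>_mult \<phi>_int_pow m_assoc)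
  have hgh: "h \<otimes> g [^] b \<otimes> inv h \<in> K" "\<phi> (h \<otimes> g [^] b \<otimes> inv h) = - (b * \<phi> g)" for b :: int
    using \<phi>_conj[OF int_pow_K[OF g(1)] h, of b] g by (simp_all add: \<phi>_int_pow)
  \<comment> \<open>Inserting \<open>inv h \<otimes> h\<close> exposes the conjugate of
    \<open>g [^] b\<close>, whence the exponent \<open>a - b\<close>.\<close>
  have "g [^] a \<otimes> h \<otimes> (g [^] b \<otimes> h) = g [^] a \<otimes> (h \<otimes> g [^] b \<otimes> inv h) \<otimes> (h \<otimes> h)" for a b :: int
    using gc hc by (simp add: m_assoc) (simp add: m_assoc[symmetric])
  then have ghgh: "g [^] a \<otimes> h \<otimes> (g [^] b \<otimes> h) \<in> K \<and>
      \<phi> (g [^] a \<otimes> h \<otimes> (g [^] b \<otimes> h)) = (a - b) * \<phi> g" for a b :: int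
    using g int_pow_K hgh hh \<phi>hh by (simp add: \<phi>_mult \<phi>_int_pow algebra_simps)
  have mult: "N #> e (a, s) \<otimes> e (b, t) = N #> e (if s then a - b else a + b, s \<noteq> t)" for a b s t
  proof (cases s)
    case False
    have "e (a, s) \<otimes> e (b, t) = e (a + b, t)"
      using gc hc False by (auto simp: e_def int_pow_mult m_assoc)
    then show ?thesis using False by simp
  next
    case True
    show ?thesis
    proof (cases t)
      case True
      have "N #> (g [^] a \<otimes> h \<otimes> (g [^] b \<otimes> h)) = N #> e (a - b, False)"
        using ghgh[of a b] eFK \<phi>F by (intro N_coset_eq_K) simp_all
      then show ?thesis using \<open>s\<close> True by (simp add: eT)
    next
      case False
      have K: "g [^] a \<otimes> h \<otimes> g [^] b \<in> carrier G - K"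
      proof
        show "g [^] a \<otimes> h \<otimes> g [^] b \<in> carrier G" using gc hc by simp
        show "g [^] a \<otimes> h \<otimes> g [^] b \<notin> K"
        proof
          assume "g [^] a \<otimes> h \<otimes> g [^] b \<in> K"
          then have "(g [^] a \<otimes> h \<otimes> g [^] b) \<otimes> inv (g [^] b) \<in> K" using int_pow_K g by blast
          then have "g [^] a \<otimes> h \<in> K" using gc hc by (simp add: m_assoc)
          then show False using eTK eT by auto
        qed
      qed
      have "\<phi> (g [^] a \<otimes> h \<otimes> g [^] b \<otimes> h) = (a - b) * \<phi> g"
        using ghgh[of a b] gc hc by (simp add: m_assoc)
      then have "N #> (g [^] a \<otimes> h \<otimes> g [^] b) = N #> e (a - b, True)"
        using N_coset_eq_notin_K[OF K eTK h] \<phi>T by simp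
      then show ?thesis using \<open>s\<close> False by (simp add: eT eF)
    qed
  qed
  define f where "f x = N #> e x" for x
  have carr: "carrier (dihedral_group 0) = UNIV"
    by (simp add: dihedral_group_def carrier_integer_mod_group)
  have Qcarr: "carrier (G Mod N) = (\<lambda>x. N #> x) ` carrier G"
    by (auto simp: FactGroup_def RCOSETS_def)
  have "f \<in> iso (dihedral_group 0) (G Mod N)"
    unfolding iso_def
  proof (intro CollectI conjI homI)
    show "f x \<in> carrier (G Mod N)" for x unfolding f_def Qcarr using ec by blast
    show "f (x \<otimes>\<^bsub>dihedral_group 0\<^esub> y) = f x \<otimes>\<^bsub>G Mod N\<^esub> f y" for x y
    proof -
      obtain a s b t where xy: "x = (a, s)" "y = (b, t)" by (cases x, cases y) blast
      have "x \<otimes>\<^bsub>dihedral_group 0\<^esub> y = (if s then a - b else a + b, s \<noteq> t)"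
        unfolding xy by (simp add: dihedral_group_def carrier_integer_mod_group)
      moreover have "f x \<otimes>\<^bsub>G Mod N\<^esub> f y = N #> e x \<otimes> e y"
        unfolding f_def using ec by (simp add: FactGroup_def N.rcos_sum)
      ultimately show ?thesis using mult unfolding f_def xy by simp
    qed
    show "bij_betw f (carrier (dihedral_group 0)) (carrier (G Mod N))"
      unfolding bij_betw_def
    proof
      show "inj_on f (carrier (dihedral_group 0))"
      proof (rule inj_onI)
        fix x y assume eq: "f x = f y"
        obtain a s b t where xy: "x = (a, s)" "y = (b, t)" by (cases x, cases y) blast
        have N: "e x \<otimes> inv (e y) \<in> N" using eq N_coset_eq_iff[OF ec ec] unfolding f_def by blast
        then have K: "e x \<otimes> inv (e y) \<in> K" by (simp add: N_def)
        have ex: "(e x \<otimes> inv (e y)) \<otimes> e y = e x" using ec by (simp add: m_assoc)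
        \<comment> \<open>The second component records whether \<open>e\<close> lies outside
          \<open>K\<close>, and left multiplication by an element of \<open>K\<close> preserves
          this.\<close>
        have st: "s = t"
        proof (rule ccontr)
          assume "s \<noteq> t"
          then consider "s" "\<not> t" | "\<not> s" "t" by blast
          then show False
          proof cases
            case 1
            then show False using K ex eTK[of a] eFK[of b] xy K.m_closed by (metis DiffD2)
          next
            case 2
            then show False using mult_notin_K[OF K] ex eTK[of b] eFK[of a] xy by (metis DiffD2)
          qed
        qed
        have "e x \<otimes> inv (e y) = g [^] a \<otimes> inv (g [^] b)"
          unfolding xy st e_def using gc hc
          by (simp add: inv_mult_group m_assoc) (simp add: m_assoc[symmetric])
        then have "(a - b) * \<phi> g = 0"
          using N g int_pow_K by (simp add: N_def \<phi>_mult \<phi>_inv \<phi>_int_pow algebra_simps)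
        then show "x = y" using g xy st by simp
      qed
      show "f ` carrier (dihedral_group 0) = carrier (G Mod N)"
      proof
        show "f ` carrier (dihedral_group 0) \<subseteq> carrier (G Mod N)"
          unfolding f_def Qcarr using ec by blast
        show "carrier (G Mod N) \<subseteq> f ` carrier (dihedral_group 0)"
        proof
          fix Z assume "Z \<in> carrier (G Mod N)"
          then obtain x where x: "x \<in> carrier G" "Z = N #> x" unfolding Qcarr by blast
          have "\<exists>y. N #> x = f y"
          proof (cases "x \<in> K")
            case True
            then obtain m where "\<phi> x = m * \<phi> g" using g by blast
            then have "N #> x = f (m, False)"
              unfolding f_def using True eFK \<phi>F by (intro N_coset_eq_K) auto
            then show ?thesis ..
          next
            case False
            then have xK: "x \<in> carrier G - K" using x by blast
            then obtain m where "\<phi> (x \<otimes> h) = m * \<phi> g" using g h mult_notin by blast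
            then have "N #> x = f (m, True)"
              unfolding f_def using N_coset_eq_notin_K[OF xK eTK h] \<phi>T by simp
            then show ?thesis ..
          qed
          then show "Z \<in> f ` carrier (dihedral_group 0)" unfolding carr x(2) by blast
        qed
      qed
    qed
  qed
  then have "dihedral_group 0 \<cong> G Mod N" unfolding is_iso_def by blast
  then have "G Mod N \<cong> dihedral_group 0" by (rule group.iso_sym[OF group_dihedral_group])
  then show ?thesis unfolding is_dihedral_def by blast
qed

end

section \<open>Ends and displacement\<close>

text \<open>The difference of cardinalities in a form that also makes sense for infinite sets with
  finite symmetric difference.\<close>

definition shift :: "'a set \<Rightarrow> 'a set \<Rightarrow> int"
  where "shift S T = int (card (S - T)) - int (card (T - S))"

text \<open>Inside a finite window the relative count becomes an honest difference, which makes
  additivity a telescoping sum.\<close>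

lemma shift_eq:
  assumes "finite W" "sym_diff S T \<subseteq> W"
  shows "shift S T = int (card (S \<inter> W)) - int (card (T \<inter> W))"
proof -
  have "card (S \<inter> W) = card (S - T) + card (S \<inter> T \<inter> W)" "card (T \<inter> W) = card (T - S) + card (S \<inter> T \<inter> W)"
    using assms by (subst card_Un_disjoint[symmetric];
      auto intro: finite_subset[OF _ assms(1)] arg_cong[where f = card])+
  then show ?thesis by (simp add: shift_def)
qed

lemma shift_add:
  assumes "finite (sym_diff S T)" "finite (sym_diff T V)"
  shows "shift S T + shift T V = shift S V"
proof -
  define W where "W = sym_diff S T \<union> sym_diff T V"
  have fin: "finite W" unfolding W_def using assms by blast
  have "sym_diff S T \<subseteq> W" "sym_diff T V \<subseteq> W" "sym_diff S V \<subseteq> W" unfolding W_def by blast+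
  from this[THEN shift_eq[OF fin]] show ?thesis by simp
qed

lemma finite_sym_diff_trans:
  "finite (sym_diff S T) \<Longrightarrow> finite (sym_diff T V) \<Longrightarrow> finite (sym_diff S V)"
  by (rule finite_subset[of _ "sym_diff S T \<union> sym_diff T V"]) blast+

lemma finite_sym_diff_commute: "finite (sym_diff S T) \<Longrightarrow> finite (sym_diff T S)"
  by (simp add: Un_commute)

context group begin

lemma sym_diff_r_coset:
  assumes "S \<subseteq> carrier G" "V \<subseteq> carrier G" "g \<in> carrier G"
  shows "sym_diff (S #> g) (V #> g) = sym_diff S V #> g"
proof -
  have "sym_diff S V #> g = ((S - V) #> g) \<union> ((V - S) #> g)" by (auto simp: r_coset_image)
  then show ?thesis using assms by (simp add: r_coset_Diff)
qed

lemma finite_sym_diff_r_coset: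
  assumes "S \<subseteq> carrier G" "V \<subseteq> carrier G" "g \<in> carrier G" "finite (sym_diff S V)"
  shows "finite (sym_diff (S #> g) (V #> g))"
  using assms finite_r_coset by (simp only: sym_diff_r_coset)

lemma shift_r_coset:
  assumes "S \<subseteq> carrier G" "V \<subseteq> carrier G" "g \<in> carrier G"
  shows "shift (S #> g) (V #> g) = shift S V"
proof -
  have "card ((S #> g) - (V #> g)) = card (S - V)" "card ((V #> g) - (S #> g)) = card (V - S)"
    using assms by (subst r_coset_Diff[symmetric]; auto intro!: card_r_coset)+
  then show ?thesis by (simp add: shift_def)
qed

lemma shift_Compl: "S \<subseteq> carrier G \<Longrightarrow> V \<subseteq> carrier G \<Longrightarrow> shift (carrier G - S) (carrier G - V) = - shift S V"
proof -
  assume "S \<subseteq> carrier G" "V \<subseteq> carrier G"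
  then have "(carrier G - S) - (carrier G - V) = V - S" "(carrier G - V) - (carrier G - S) = S - V" by auto
  then show ?thesis by (simp add: shift_def)
qed

lemma sym_diff_Compl:
  "S \<subseteq> carrier G \<Longrightarrow> V \<subseteq> carrier G \<Longrightarrow> sym_diff (carrier G - S) (carrier G - V) = sym_diff S V"
  by blast

end

section \<open>At most two ends\<close>

context plateau begin

text \<open>Otherwise take a disjoint family \<open>F\<close> of maximal size. Moving a ball that contains all
  boundaries deep into one member of \<open>F\<close> gives a translated family that, but for one member,
  lies inside that one.\<close>

lemma no_three_ends:
  assumes P: "tame P1" "tame P2" "tame P3" "infinite P1" "infinite P2" "infinite P3"
    and disj: "P1 \<inter> P2 = {}" "P1 \<inter> P3 = {}" "P2 \<inter> P3 = {}"
  shows False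
proof -
  define Fam where "Fam F \<longleftrightarrow> finite F \<and> (\<forall>S\<in>F. tame S \<and> infinite S) \<and> disjoint F" for F
  have F0: "Fam {P1, P2, P3}" using P disj unfolding Fam_def disjoint_def by auto
  have "P1 \<noteq> {}" "P2 \<noteq> {}" "P3 \<noteq> {}" using P by auto
  then have "P1 \<noteq> P2" "P1 \<noteq> P3" "P2 \<noteq> P3" using disj by auto
  then have c0: "card {P1, P2, P3} = 3" by simp
  have bound: "\<forall>F. Fam F \<longrightarrow> card F < Suc q" unfolding Fam_def using card_disjoint_tame_le by fastforce
  obtain F where F: "Fam F" and Fmax: "\<And>F'. Fam F' \<Longrightarrow> card F' \<le> card F"
    using ex_has_greatest_nat[of Fam _ card "Suc q"] F0 bound by blast
  have F3: "3 \<le> card F" using Fmax[OF F0] c0 by simp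
  have Ff: "finite F" and Ft: "\<And>S. S \<in> F \<Longrightarrow> tame S" and Fi: "\<And>S. S \<in> F \<Longrightarrow> infinite S"
    and Fd: "\<And>S S'. S \<in> F \<Longrightarrow> S' \<in> F \<Longrightarrow> S \<noteq> S' \<Longrightarrow> S \<inter> S' = {}"
    using F unfolding Fam_def disjoint_def by auto
  have Fc: "S \<subseteq> carrier G" if "S \<in> F" for S using Ft[OF that] by (simp add: tame_def)
  have "finite (\<Union>S\<in>F. inner_bd S \<union> inner_bd (carrier G - S))"
    using Ff Ft tame_inner_bd tame_Compl by blast
  moreover have "(\<Union>S\<in>F. inner_bd S \<union> inner_bd (carrier G - S)) \<subseteq> carrier G"
    using Fc unfolding inner_bd_def by blast
  ultimately obtain \<rho> where \<rho>: "(\<Union>S\<in>F. inner_bd S \<union> inner_bd (carrier G - S)) \<subseteq> ball \<rho>"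
    using finite_subset_ball by blast
  have \<rho>1: "inner_bd S \<subseteq> ball \<rho>" and \<rho>2: "inner_bd (carrier G - S) \<subseteq> ball \<rho>" if "S \<in> F" for S
    using \<rho> that by auto
  obtain U where U: "U \<in> F" using F3 by fastforce
  \<comment> \<open>A point of \<open>U\<close> this far out makes \<open>ball \<rho>\<close> and
    its translate by \<open>g\<close> disjoint.\<close>
  have "\<not> U \<subseteq> ball (\<rho> + \<rho>)" using Fi[OF U] finite_ball finite_subset by blast
  then obtain g where g: "g \<in> U" "g \<notin> ball (\<rho> + \<rho>)" by blast
  have gc: "g \<in> carrier G" using g Fc U by blast
  have far: "ball \<rho> \<inter> (ball \<rho> #> g) = {}"
  proof (rule ccontr)
    assume "ball \<rho> \<inter> (ball \<rho> #> g) \<noteq> {}"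
    then obtain x z where xz: "x \<in> ball \<rho>" "z \<in> ball \<rho>" "x = z \<otimes> g" unfolding r_coset_image by blast
    then have "g = inv z \<otimes> x" using gc ball_carrier by (simp add: m_assoc[symmetric])
    then show False using g ball_mult ball_inv xz by blast
  qed
  have gU: "ball \<rho> #> g \<subseteq> U"
  proof (rule ball_translate_dichotomy[OF Fc[OF U] gc])
    have "\<one> \<otimes> g \<in> ball \<rho> #> g" unfolding r_coset_image using one_ball by (rule imageI)
    then show "U \<inter> (ball \<rho> #> g) \<noteq> {}" using g gc by auto
  qed (use far \<rho>1[OF U] \<rho>2[OF U] in blast)+
  have Sc: "S #> g \<subseteq> carrier G" if "S \<in> F" for S using Fc[OF that] gc by (simp add: r_coset_subset_G)
  have inn: "inner_bd (S #> g) \<subseteq> ball \<rho> #> g" "inner_bd (carrier G - (S #> g)) \<subseteq> ball \<rho> #> g"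
    if "S \<in> F" for S
  proof -
    show "inner_bd (S #> g) \<subseteq> ball \<rho> #> g"
      using inner_bd_r_coset[OF Fc[OF that] gc] r_coset_mono[OF \<rho>1[OF that]] by simp
    show "inner_bd (carrier G - (S #> g)) \<subseteq> ball \<rho> #> g"
      using inner_bd_r_coset[of "carrier G - S" g] gc r_coset_mono[OF \<rho>2[OF that]]
        r_coset_Compl[OF Fc[OF that] gc] by simp
  qed
  have dich: "\<one> \<in> S #> g" if S: "S \<in> F" and meet: "(S #> g) \<inter> ball \<rho> \<noteq> {}" for S
  proof -
    have b1: "ball \<rho> #> \<one> = ball \<rho>" using ball_closed by simp
    have "ball \<rho> #> \<one> \<subseteq> S #> g"
    proof (rule ball_translate_dichotomy[OF Sc[OF S] one_closed])
    qed (use far inn[OF S] meet b1 in auto)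
    then show ?thesis using b1 one_ball by blast
  qed
  define M where "M = {S \<in> F. (S #> g) \<inter> ball \<rho> \<noteq> {}}"
  \<comment> \<open>A translated member that meets \<open>ball \<rho>\<close> contains
    \<open>\<one>\<close>, and disjoint sets cannot share it.\<close>
  have M1: "card M \<le> 1"
  proof (rule card_le_Suc0_iff_eq[THEN iffD2, unfolded One_nat_def[symmetric]])
    show "finite M" unfolding M_def using Ff by simp
    show "\<forall>S\<in>M. \<forall>S'\<in>M. S = S'"
    proof (intro ballI, rule ccontr)
      fix S S' assume SS: "S \<in> M" "S' \<in> M" "S \<noteq> S'"
      then have FF: "S \<in> F" "S' \<in> F" unfolding M_def by auto
      have "\<one> \<in> (S #> g) \<inter> (S' #> g)" using SS dich unfolding M_def by blast
      then have "\<one> \<in> (S \<inter> S') #> g" using r_coset_Int[OF Fc[OF FF(1)] Fc[OF FF(2)] gc] by simp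
      then show False using Fd[OF FF SS(3)] by (simp add: r_coset_image)
    qed
  qed
  define F1 where "F1 = F - M"
  define F2 where "F2 = (\<lambda>S. S #> g) ` F1"
  have F1F: "F1 \<subseteq> F" unfolding F1_def by blast
  have F1m: "(S #> g) \<inter> ball \<rho> = {}" if "S \<in> F1" for S using that unfolding F1_def M_def by blast
  have inj: "inj_on (\<lambda>S. S #> g) F1"
  proof (rule inj_onI)
    fix S S' assume S: "S \<in> F1" "S' \<in> F1" "S #> g = S' #> g"
    have "S \<subseteq> carrier G" "S' \<subseteq> carrier G" using S F1F Fc by auto
    then have "(S #> g) #> inv g = S" "(S' #> g) #> inv g = S'"
      using gc by (simp_all add: coset_mult_assoc)
    then show "S = S'" using S(3) by metis
  qed
  have card2: "card F - 1 \<le> card F2"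
  proof -
    have "card F2 = card F1" unfolding F2_def by (rule card_image[OF inj])
    moreover have "card F1 = card F - card M"
      unfolding F1_def by (rule card_Diff_subset) (use Ff in \<open>auto simp: M_def\<close>)
    ultimately show ?thesis using M1 by linarith
  qed
  \<comment> \<open>A kept translate avoids \<open>ball \<rho>\<close>, hence the inner boundary of
    \<open>L\<close>; its own inner boundary lies in \<open>ball \<rho> #> g \<subseteq> U\<close>,
    away from \<open>L\<close>.\<close>
  have cross: "L \<inter> S' = {}" if L: "L \<in> F - {U}" and S': "S' \<in> F2" for L S'
  proof -
    obtain S where S: "S \<in> F1" "S' = S #> g" using S' unfolding F2_def by blast
    have SF: "S \<in> F" using S F1F by blast
    have LF: "L \<in> F" "L \<noteq> U" using L by auto
    show ?thesis unfolding S(2)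
    proof (rule disjoint_of_inner_bd)
      show "inner_bd L \<inter> (S #> g) = {}" using \<rho>1[OF LF(1)] F1m[OF S(1)] by blast
      show "inner_bd (S #> g) \<inter> L = {}" using inn(1)[OF SF] gU Fd[OF LF(1) U LF(2)] by blast
      show "L \<noteq> carrier G" using Fd[OF LF(1) U LF(2)] g gc by blast
    qed (use Fc LF Sc SF in auto)
  qed
  have F2i: "infinite S' \<and> tame S'" if "S' \<in> F2" for S'
    using that F1F Fi Ft Fc gc unfolding F2_def by (auto simp: finite_r_coset_iff tame_r_coset subset_eq)
  \<comment> \<open>This family has at least \<open>2 * (card F - 1)\<close> members, more than
    \<open>card F\<close> once \<open>card F \<ge> 3\<close>.\<close>
  have "Fam (F2 \<union> (F - {U}))" unfolding Fam_def disjoint_def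
  proof (intro conjI ballI impI)
    show "finite (F2 \<union> (F - {U}))" unfolding F2_def F1_def using Ff by simp
    show "tame S" "infinite S" if "S \<in> F2 \<union> (F - {U})" for S
      using that F2i Ft Fi by auto
    fix S S' assume S: "S \<in> F2 \<union> (F - {U})" "S' \<in> F2 \<union> (F - {U})" "S \<noteq> S'"
    show "S \<inter> S' = {}"
    proof (cases "S \<in> F2 \<and> S' \<in> F2")
      case True
      then obtain L L' where L: "L \<in> F1" "L' \<in> F1" "S = L #> g" "S' = L' #> g"
        unfolding F2_def by blast
      then have "L \<inter> L' = {}" "L \<subseteq> carrier G" "L' \<subseteq> carrier G"
        using Fd[of L L'] F1F Fc S(3) by blast+
      then show ?thesis using r_coset_Int[of L L' g] gc unfolding L(3,4) by (simp add: r_coset_def)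
    next
      case False
      then show ?thesis using S cross Fd by blast
    qed
  qed
  then have "card (F2 \<union> (F - {U})) \<le> card F" by (rule Fmax)
  moreover have "card (F2 \<union> (F - {U})) = card F2 + card (F - {U})"
  proof (rule card_Un_disjoint)
    show "F2 \<inter> (F - {U}) = {}"
    proof (rule ccontr)
      assume "F2 \<inter> (F - {U}) \<noteq> {}"
      then obtain S where "S \<in> F2" "S \<in> F - {U}" by blast
      then have "S = {}" using cross[of S S] by blast
      then show False using F2i[OF \<open>S \<in> F2\<close>] by simp
    qed
  qed (use Ff in \<open>auto simp: F2_def F1_def\<close>)
  moreover have "card (F - {U}) = card F - 1" using U by simp
  ultimately show False using card2 F3 by linarith
qed

end

text \<open>Two ends in Boolean terms: modulo finite sets, the algebra of tame sets has just four
  elements.\<close>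

locale two_ended = cayley_graph +
  fixes U :: "'a set"
  assumes tame_U: "tame U" and infinite_U: "infinite U" and infinite_Compl_U: "infinite (carrier G - U)"
    and end_cases: "\<And>P. tame P \<Longrightarrow> infinite P \<Longrightarrow> infinite (carrier G - P) \<Longrightarrow>
      finite (sym_diff U P) \<or> finite (sym_diff (carrier G - U) P)"
begin

definition K :: "'a set"
  where "K = {g \<in> carrier G. finite (sym_diff U (U #> g))}"

definition \<phi> :: "'a \<Rightarrow> int"
  where "\<phi> g = shift U (U #> g)"

lemma U_closed: "U \<subseteq> carrier G"
  using tame_U by (simp add: tame_def)

lemma K_carrier: "g \<in> K \<Longrightarrow> g \<in> carrier G"
  by (simp add: K_def)

lemma U_r_coset_closed: "g \<in> carrier G \<Longrightarrow> U #> g \<subseteq> carrier G"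
  using U_closed by (simp add: r_coset_subset_G)

lemma notin_K: "g \<in> carrier G \<Longrightarrow> g \<notin> K \<Longrightarrow> finite (sym_diff (carrier G - U) (U #> g))"
proof -
  assume g: "g \<in> carrier G" "g \<notin> K"
  have "infinite (U #> g)" using infinite_U finite_r_coset_iff U_closed g by simp
  moreover have "infinite (carrier G - (U #> g))"
    using infinite_Compl_U finite_r_coset_iff[of "carrier G - U" g] r_coset_Compl[OF U_closed] g by simp
  ultimately show ?thesis using end_cases[OF tame_r_coset[OF tame_U g(1)]] g by (auto simp: K_def)
qed

lemma U_r_coset_mult:
  "g \<in> carrier G \<Longrightarrow> h \<in> carrier G \<Longrightarrow> U #> (g \<otimes> h) = (U #> g) #> h"
  using U_closed by (simp add: coset_mult_assoc)

text \<open>The displacement of \<open>g \<otimes> h\<close> is split at \<open>U #> h\<close>; the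
  second part is the displacement of \<open>g\<close>, translated by \<open>h\<close>.\<close>

lemma K_mult:
  assumes "g \<in> K" "h \<in> K"
  shows "g \<otimes> h \<in> K" "\<phi> (g \<otimes> h) = \<phi> g + \<phi> h"
proof -
  have c: "g \<in> carrier G" "h \<in> carrier G" using assms K_carrier by auto
  have 1: "finite (sym_diff U (U #> h))" using assms by (simp add: K_def)
  have 2: "finite (sym_diff (U #> h) (U #> (g \<otimes> h)))"
    unfolding U_r_coset_mult[OF c]
    using assms by (intro finite_sym_diff_r_coset U_closed U_r_coset_closed c) (simp add: K_def)
  show "g \<otimes> h \<in> K" unfolding K_def using finite_sym_diff_trans[OF 1 2] c by simp
  have "shift (U #> h) (U #> (g \<otimes> h)) = \<phi> g"
    unfolding U_r_coset_mult[OF c] \<phi>_def by (intro shift_r_coset U_closed U_r_coset_closed c)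
  then show "\<phi> (g \<otimes> h) = \<phi> g + \<phi> h" using shift_add[OF 1 2] by (simp add: \<phi>_def)
qed

lemma K_inv:
  assumes "g \<in> K"
  shows "inv g \<in> K"
proof -
  have c: "g \<in> carrier G" using assms K_carrier by auto
  have "finite (sym_diff (U #> inv g) ((U #> g) #> inv g))"
    using assms c by (intro finite_sym_diff_r_coset U_closed U_r_coset_closed) (auto simp: K_def)
  moreover have "(U #> g) #> inv g = U" using c U_closed by (simp add: coset_mult_assoc)
  ultimately have "finite (sym_diff (U #> inv g) U)" by (simp only:)
  then show ?thesis using finite_sym_diff_commute c unfolding K_def by blast
qed

text \<open>Elements outside \<open>K\<close> exchange \<open>U\<close> and its complement up to
  finite sets, so two exchanges restore \<open>U\<close>.\<close>

lemma mult_notin_K: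
  assumes "g \<in> carrier G - K" "h \<in> carrier G - K"
  shows "g \<otimes> h \<in> K"
proof -
  have c: "g \<in> carrier G" "h \<in> carrier G" using assms by auto
  have "finite (sym_diff (carrier G - U) (U #> h))" using notin_K assms by blast
  then have 1: "finite (sym_diff U (carrier G - (U #> h)))"
    using sym_diff_Compl[of "carrier G - U" "U #> h"] U_closed U_r_coset_closed[OF c(2)]
    by (simp add: double_diff)
  have "finite (sym_diff ((carrier G - U) #> h) ((U #> g) #> h))"
    using notin_K assms c by (intro finite_sym_diff_r_coset U_r_coset_closed) auto
  then have 2: "finite (sym_diff (carrier G - (U #> h)) (U #> (g \<otimes> h)))"
    using U_r_coset_mult[OF c] r_coset_Compl[OF U_closed c(2)] by simp
  show ?thesis unfolding K_def using finite_sym_diff_trans[OF 1 2] c by simp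
qed

text \<open>Up to a finite set \<open>U #> h\<close> is the complement \<open>C\<close>, which
  \<open>g\<close> displaces by \<open>- \<phi> g\<close>. Passing from \<open>C\<close> to
  \<open>U #> h\<close> adds a correction and its translate, which cancel; translation by
  \<open>inv h\<close> then leads back to \<open>U\<close>.\<close>

lemma \<phi>_conj:
  assumes g: "g \<in> K" and h: "h \<in> carrier G - K"
  shows "h \<otimes> g \<otimes> inv h \<in> K" "\<phi> (h \<otimes> g \<otimes> inv h) = - \<phi> g"
proof -
  have c: "g \<in> carrier G" "h \<in> carrier G" using g h K_carrier by auto
  define C where "C = carrier G - U"
  have Cc: "C \<subseteq> carrier G" "C #> g \<subseteq> carrier G" "C #> g = carrier G - (U #> g)"
    unfolding C_def using c r_coset_Compl[OF U_closed c(1)] by auto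
  have hUc: "U #> h \<subseteq> carrier G" "(U #> h) #> g \<subseteq> carrier G"
    using U_r_coset_closed c r_coset_subset_G by auto
  have "finite (sym_diff C (U #> h))" unfolding C_def using notin_K h by blast
  then have 1: "finite (sym_diff (U #> h) C)" by (rule finite_sym_diff_commute)
  have 2: "finite (sym_diff C (C #> g))" unfolding Cc(3) unfolding C_def
    using g sym_diff_Compl[OF U_closed U_r_coset_closed[OF c(1)]] by (simp add: K_def)
  have 3: "finite (sym_diff (C #> g) ((U #> h) #> g))"
    by (rule finite_sym_diff_r_coset[OF Cc(1) hUc(1) c(1) finite_sym_diff_commute[OF 1]])
  have fin: "finite (sym_diff (U #> h) ((U #> h) #> g))"
    using finite_sym_diff_trans[OF finite_sym_diff_trans[OF 1 2] 3] .
  have sh: "shift (U #> h) ((U #> h) #> g) = - \<phi> g"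
  proof -
    have "shift (U #> h) ((U #> h) #> g) = shift (U #> h) C + (shift C (C #> g) + shift (C #> g) ((U #> h) #> g))"
      using shift_add[OF 1 2] shift_add[OF finite_sym_diff_trans[OF 1 2] 3] by simp
    moreover have "shift C (C #> g) = - \<phi> g"
      unfolding Cc(3) unfolding C_def \<phi>_def
      by (rule shift_Compl[OF U_closed U_r_coset_closed[OF c(1)]])
    moreover have "shift (C #> g) ((U #> h) #> g) = shift C (U #> h)"
      by (rule shift_r_coset[OF Cc(1) hUc(1) c(1)])
    moreover have "shift C (U #> h) = - shift (U #> h) C" by (simp add: shift_def)
    ultimately show ?thesis by simp
  qed
  have e: "(U #> h) #> inv h = U" "((U #> h) #> g) #> inv h = U #> (h \<otimes> g \<otimes> inv h)"
    using c U_closed by (simp_all add: coset_mult_assoc m_assoc r_coset_subset_G)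
  have "finite (sym_diff ((U #> h) #> inv h) (((U #> h) #> g) #> inv h))"
    by (rule finite_sym_diff_r_coset[OF hUc _ fin]) (use c in simp)
  then show "h \<otimes> g \<otimes> inv h \<in> K" unfolding e K_def using c by simp
  have "shift ((U #> h) #> inv h) (((U #> h) #> g) #> inv h) = - \<phi> g"
    unfolding sh[symmetric] by (rule shift_r_coset[OF hUc]) (use c in simp)
  then show "\<phi> (h \<otimes> g \<otimes> inv h) = - \<phi> g" unfolding e \<phi>_def .
qed

text \<open>If \<open>g\<close> is far from \<open>\<one>\<close>, then \<open>U\<close> and its translate have far-apart boundaries, so they are
  strictly nested up to complements.\<close>

lemma finite_kernel: "finite {g \<in> K. \<phi> g = 0}"
proof -
  define C where "C = carrier G - U"
  have Cc: "C \<subseteq> carrier G" "carrier G - C = U" unfolding C_def using U_closed by auto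
  have "finite (inner_bd U \<union> inner_bd C)"
    unfolding C_def using tame_inner_bd tame_U tame_Compl by blast
  moreover have "inner_bd U \<union> inner_bd C \<subseteq> carrier G"
    using U_closed Cc unfolding inner_bd_def by blast
  ultimately obtain \<rho> where \<rho>: "inner_bd U \<union> inner_bd C \<subseteq> ball \<rho>"
    by (rule finite_subset_ball)
  have "{g \<in> K. \<phi> g = 0} \<subseteq> ball (\<rho> + \<rho>)"
  proof (rule subsetI, rule ccontr)
    fix g assume gK: "g \<in> {g \<in> K. \<phi> g = 0}" and gb: "g \<notin> ball (\<rho> + \<rho>)"
    have gc: "g \<in> carrier G" using gK K_carrier by blast
    have Cg: "C #> g = carrier G - (U #> g)" unfolding C_def by (rule r_coset_Compl[OF U_closed gc])
    have far: "ball \<rho> \<inter> (ball \<rho> #> g) = {}"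
    proof (rule ccontr)
      assume "ball \<rho> \<inter> (ball \<rho> #> g) \<noteq> {}"
      then obtain x z where xz: "x \<in> ball \<rho>" "z \<in> ball \<rho>" "x = z \<otimes> g" unfolding r_coset_image by blast
      then have "g = inv z \<otimes> x" using gc ball_carrier by (simp add: m_assoc[symmetric])
      then show False using gb ball_mult ball_inv xz by blast
    qed
    have fin: "finite (sym_diff U (U #> g))" and eq: "card (U - (U #> g)) = card ((U #> g) - U)"
      using gK by (auto simp: K_def \<phi>_def shift_def)
    have gU: "inner_bd (U #> g) \<subseteq> ball \<rho> #> g" "inner_bd (C #> g) \<subseteq> ball \<rho> #> g"
      using inner_bd_r_coset[OF U_closed gc] inner_bd_r_coset[OF Cc(1) gc] r_coset_mono \<rho> by auto
    \<comment> \<open>The translated ball avoids both inner boundaries, hence lies on one side of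
      \<open>U\<close>; the roles are exchanged for \<open>Q\<close> below.\<close>
    have "\<exists>P\<in>{U, C}. P \<inter> (ball \<rho> #> g) = {}"
    proof (rule ccontr)
      assume "\<not> ?thesis"
      then have "U \<inter> (ball \<rho> #> g) \<noteq> {}" "C \<inter> (ball \<rho> #> g) \<noteq> {}" by auto
      moreover have "inner_bd U \<inter> (ball \<rho> #> g) = {}" "inner_bd (carrier G - U) \<inter> (ball \<rho> #> g) = {}"
        using \<rho> far unfolding C_def by auto
      ultimately have "ball \<rho> #> g \<subseteq> U" using ball_translate_dichotomy[OF U_closed gc] by blast
      then show False using \<open>C \<inter> (ball \<rho> #> g) \<noteq> {}\<close> unfolding C_def by blast
    qed
    then obtain P where P: "P \<in> {U, C}" "P \<inter> (ball \<rho> #> g) = {}" by blast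
    have "\<exists>Q\<in>{U #> g, C #> g}. Q \<inter> ball \<rho> = {}"
    proof (rule ccontr)
      assume "\<not> ?thesis"
      then have m: "(U #> g) \<inter> ball \<rho> \<noteq> {}" "(C #> g) \<inter> ball \<rho> \<noteq> {}" by auto
      have b1: "ball \<rho> #> \<one> = ball \<rho>" using ball_closed by simp
      have "ball \<rho> #> \<one> \<subseteq> U #> g"
        by (rule ball_translate_dichotomy[OF U_r_coset_closed[OF gc] one_closed])
          (use m(1) gU far b1 Cg in auto)
      then show False using m(2) b1 unfolding Cg by blast
    qed
    then obtain Q where Q: "Q \<in> {U #> g, C #> g}" "Q \<inter> ball \<rho> = {}" by blast
    have "P \<inter> Q = {}"
    proof (rule disjoint_of_inner_bd)
      show "P \<subseteq> carrier G" using P U_closed Cc by auto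
      show "Q \<subseteq> carrier G" using Q U_r_coset_closed[OF gc] Cg by auto
      show "inner_bd P \<inter> Q = {}" using P Q \<rho> by auto
      show "inner_bd Q \<inter> P = {}" using P Q gU by auto
      have "U \<noteq> {}" "C \<noteq> {}"
        using infinite_U infinite_Compl_U unfolding C_def by (metis finite.emptyI)+
      then show "P \<noteq> carrier G" using P(1) U_closed unfolding C_def by blast
    qed
    \<comment> \<open>These are the four choices of \<open>P\<close> and \<open>Q\<close>.
      Disjointness contradicts the finite symmetric difference, and nestedness with zero
      displacement forces equality.\<close>
    then consider "U \<inter> (U #> g) = {}" | "C \<inter> (C #> g) = {}" | "U \<subseteq> U #> g" | "U #> g \<subseteq> U"
      using P(1) Q(1) U_closed U_r_coset_closed[OF gc] unfolding Cg unfolding C_def by auto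
    then have "U = U #> g"
    proof cases
      case 1
      then have "U \<subseteq> sym_diff U (U #> g)" by blast
      then show ?thesis using fin infinite_U finite_subset by blast
    next
      case 2
      then have "C \<subseteq> sym_diff U (U #> g)" unfolding Cg unfolding C_def by blast
      then show ?thesis using fin infinite_Compl_U finite_subset unfolding C_def by blast
    next
      case 3
      then have "card ((U #> g) - U) = 0" using eq by (metis Diff_eq_empty_iff card.empty)
      then show ?thesis using fin 3 by auto
    next
      case 4
      then have "card (U - (U #> g)) = 0" using eq by (metis Diff_eq_empty_iff card.empty)
      then show ?thesis using fin 4 by auto
    qed
    \<comment> \<open>A translate equal to \<open>U\<close> has the same inner boundary, which would
      lie in two disjoint balls.\<close>
    then have "inner_bd U \<subseteq> ball \<rho> \<inter> (ball \<rho> #> g)" using gU(1) \<rho> by auto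
    then have "inner_bd U = {}" using far by blast
    moreover have "inner_bd U \<noteq> {}"
      by (rule inner_bd_nonempty[OF U_closed]) (use infinite_U infinite_Compl_U in auto)
    ultimately show False by blast
  qed
  then show ?thesis using finite_ball finite_subset by blast
qed

sublocale reflected_hom G K \<phi>
proof
  show "K \<subseteq> carrier G" using K_carrier by blast
  show "\<one> \<in> K" unfolding K_def using U_closed by simp
qed (use K_mult K_inv mult_notin_K \<phi>_conj finite_kernel infinite_G in auto)

end

section \<open>Two-endedness of the group and the final bound\<close>

context plateau begin

text \<open>\<open>U\<close> and \<open>P\<close> with their complements cut out four tame pieces,
  of which no three are infinite. Since all four sets are infinite, exactly two opposite pieces are,
  so \<open>P\<close> agrees with \<open>U\<close> or its complement up to a finite set.\<close>

lemma ex_two_ended: "\<exists>U. two_ended G B U"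
proof -
  obtain U where U: "tame U" "infinite U" "infinite (carrier G - U)" by (rule ex_end)
  have Uc: "U \<subseteq> carrier G" using U by (simp add: tame_def)
  have "two_ended G B U"
  proof
    fix P assume P: "tame P" "infinite P" "infinite (carrier G - P)"
    have Pc: "P \<subseteq> carrier G" using P by (simp add: tame_def)
    define U' P' where "U' = carrier G - U" and "P' = carrier G - P"
    have t: "tame (U \<inter> P)" "tame (U \<inter> P')" "tame (U' \<inter> P)" "tame (U' \<inter> P')"
      using tame_Int tame_Compl U P unfolding U'_def P'_def by auto
    have d: "U \<inter> U' = {}" "P \<inter> P' = {}" unfolding U'_def P'_def by auto
    have i: "infinite (U \<inter> P) \<or> infinite (U \<inter> P')" "infinite (U' \<inter> P) \<or> infinite (U' \<inter> P')"
      "infinite (U \<inter> P) \<or> infinite (U' \<inter> P)" "infinite (U \<inter> P') \<or> infinite (U' \<inter> P')"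
    proof -
      have "U = (U \<inter> P) \<union> (U \<inter> P')" "U' = (U' \<inter> P) \<union> (U' \<inter> P')"
        "P = (U \<inter> P) \<union> (U' \<inter> P)" "P' = (U \<inter> P') \<union> (U' \<inter> P')"
        using Uc Pc unfolding U'_def P'_def by auto
      moreover have "infinite U'" "infinite P'" using U P unfolding U'_def P'_def by auto
      ultimately show "infinite (U \<inter> P) \<or> infinite (U \<inter> P')" "infinite (U' \<inter> P) \<or> infinite (U' \<inter> P')"
        "infinite (U \<inter> P) \<or> infinite (U' \<inter> P)" "infinite (U \<inter> P') \<or> infinite (U' \<inter> P')"
        using U P finite_UnI by metis+
    qed
    have "finite (U \<inter> P) \<or> finite (U \<inter> P') \<or> finite (U' \<inter> P)"
      using no_three_ends[OF t(1,2,3)] d by blast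
    moreover have "finite (U \<inter> P) \<or> finite (U \<inter> P') \<or> finite (U' \<inter> P')"
      using no_three_ends[OF t(1,2,4)] d by blast
    moreover have "finite (U \<inter> P) \<or> finite (U' \<inter> P) \<or> finite (U' \<inter> P')"
      using no_three_ends[OF t(1,3,4)] d by blast
    moreover have "finite (U \<inter> P') \<or> finite (U' \<inter> P) \<or> finite (U' \<inter> P')"
      using no_three_ends[OF t(2,3,4)] d by blast
    ultimately have "finite (U \<inter> P') \<and> finite (U' \<inter> P) \<or> finite (U \<inter> P) \<and> finite (U' \<inter> P')"
      using i by blast
    moreover have "sym_diff U P = (U \<inter> P') \<union> (U' \<inter> P)"
      "sym_diff (carrier G - U) P = (U \<inter> P) \<union> (U' \<inter> P')"
      using Uc Pc unfolding U'_def P'_def by auto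
    ultimately show "finite (sym_diff U P) \<or> finite (sym_diff (carrier G - U) P)" by auto
  qed (use U in auto)
  then show ?thesis ..
qed

lemma ex_cyclic_or_dihedral_quotient:
  "\<exists>N. N \<lhd> G \<and> finite N \<and> 2 * card N \<le> q \<and> (cyclic_group (G Mod N) \<or> is_dihedral (G Mod N))"
proof -
  obtain U where "two_ended G B U" using ex_two_ended by blast
  then interpret two_ended G B U .
  show ?thesis
    using normal_N finite_N card_normal_le cyclic_quotient dihedral_quotient by blast
qed

end

theorem theorem1p3:
  fixes G :: "('a, 'b) monoid_scheme" and A B :: "'a set"
  assumes "group G" and "infinite (carrier G)"
    and "B \<subseteq> carrier G" and "finite B" and "set_inv\<^bsub>G\<^esub> B = B"
    and "generate G B = carrier G" and "\<one>\<^bsub>G\<^esub> \<in> B"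
    and "A \<subseteq> carrier G" and "finite A"
    and "real (card (B <#>\<^bsub>G\<^esub> A)) < real (card A) + 1 / 2 * real (card A) powr (1 / 3)"
  shows "\<exists>N. N \<lhd> G \<and> finite N \<and>
           (cyclic_group (G Mod N) \<or> is_dihedral (G Mod N)) \<and>
           real (card N) < 1 / 4 * real (card A) powr (1 / 3)"
proof -
  interpret group G by fact
  interpret cayley_graph G B
  proof
    show "inv\<^bsub>G\<^esub> b \<in> B" if "b \<in> B" for b
      using that assms(5) unfolding SET_INV_def by blast
  qed (use assms in auto)
  define k where "k = card (bd A)"
  have "card (B <#>\<^bsub>G\<^esub> A) = card A + k" unfolding k_def by (rule card_nb[OF assms(9,8)])
  then have kA: "2 * real k < real (card A) powr (1 / 3)" using assms(10) by simp
  have "8 * k ^ 3 < card A"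
  proof -
    have "(2 * real k) ^ 3 < (real (card A) powr (1 / 3)) ^ 3"
      using kA by (intro power_strict_mono) auto
    also have "\<dots> = real (card A)"
    proof -
      \<comment> \<open>For empty \<open>A\<close> the convention \<open>0 powr (1 / 3) = 0\<close>
        contradicts \<open>kA\<close>.\<close>
      have "real (card A) \<noteq> 0" using kA by (intro notI) simp
      then show ?thesis by (simp add: powr_power)
    qed
    finally have "real (8 * k ^ 3) < real (card A)" by (simp add: power_mult_distrib)
    then show ?thesis by (simp only: of_nat_less_iff)
  qed
  then obtain R q T where "q \<le> k" and pl:
    "\<And>S. finite S \<Longrightarrow> S \<subseteq> carrier G \<Longrightarrow> ball R \<subseteq> S \<Longrightarrow> q \<le> card (bd S)"
    "finite T" "T \<subseteq> carrier G" "ball (Suc R) \<subseteq> T" "card (bd T) \<le> q"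
    using ex_plateau[OF assms(9,8) k_def] by metis
  interpret plateau G B R q T by unfold_locales (use pl in auto)
  obtain N where N: "N \<lhd> G" "finite N" "2 * card N \<le> q"
    "cyclic_group (G Mod N) \<or> is_dihedral (G Mod N)"
    using ex_cyclic_or_dihedral_quotient by blast
  have "2 * real (card N) \<le> real k" using N(3) \<open>q \<le> k\<close> by linarith
  then have "real (card N) < 1 / 4 * real (card A) powr (1 / 3)" using kA by linarith
  then show ?thesis using N by blast
qed

end
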